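(* Let $G$ be a finitely generated group with $G\wr H\le G$ for some non-trivial group $H$ (i.e. $G$ contains a subgroup isomorphic to $G\wr H$). Then $G$ is uniformly SENS.
   Context: $G\wr H$ denotes the restricted regular wreath product $G^{(H)}\rtimes H$, where $G^{(H)}$ is the group of finitely supported maps $H\to G$ under pointwise multiplication and $H$ acts by $({}^hf)(y)=f(yh)$. A finite standard generating set of a finitely generated group $G$ is $\Sigma=S\cup S^{-1}\cup\{1\}$, where $S$ is a finite set together with a surjective homomorphism from the free group on $S$ onto $G$; words over $\Sigma$ are evaluated in $G$, the letter $1$ evaluating to the identity. For words, $(a_1\cdots a_n)^{-1}=a_n^{-1}\cdots a_1^{-1}$ and $[h,g]=h^{-1}g^{-1}hg$. $G$ is strongly efficiently non-solvable (SENS) if there is a constant $\mu\in\mathbb{N}$ such that for every $d\in\mathbb{N}$ there are words $g_{d,v}\in\Sigma^*$ for $v\in\{0,1\}^{\le d}$ with (a) $|g_{d,v}|=2^{\mu d}$ for $v\in\{0,1\}^d$; (b) $g_{d,v}=[g_{d,v0},g_{d,v1}]$ (as words) for $v\in\{0,1\}^{<d}$; (c) $g_{d,\varepsilon}\neq1$ in $G$. It is uniformly SENS if moreover (d) given $v\in\{0,1\}^d$, a number $i$ in binary with $\mu d$ bits, and $a\in\Sigma$, one can decide in $\mathsf{DLINTIME}$ (deterministic linear time, on Turing machines with random access to the input) whether the $i$-th letter of $g_{d,v}$ is $a$. These properties do not depend on the choice of $\Sigma$. *)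

theory Defs
  imports "HOL-Algebra.Generated_Groups"
begin

section \<open>Restricted regular wreath products\<close>

definition fin_supp_maps :: "('a, 'm) monoid_scheme \<Rightarrow> ('h, 'n) monoid_scheme \<Rightarrow> ('h \<Rightarrow> 'a) set" where
  "fin_supp_maps G H =
     {f \<in> carrier H \<rightarrow>\<^sub>E carrier G. finite {y \<in> carrier H. f y \<noteq> \<one>\<^bsub>G\<^esub>}}"

definition shift_map :: "('h, 'n) monoid_scheme \<Rightarrow> 'h \<Rightarrow> ('h \<Rightarrow> 'a) \<Rightarrow> ('h \<Rightarrow> 'a)" where
  "shift_map H h f = (\<lambda>y\<in>carrier H. f (y \<otimes>\<^bsub>H\<^esub> h))"

text \<open>The multiplication is that of the semidirect product for the left action
  \<^const>\<open>shift_map\<close>: \<open>(f\<^sub>1, h\<^sub>1) (f\<^sub>2, h\<^sub>2)\<close> has first component \<open>f\<^sub>1\<close> times the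
  \<open>h\<^sub>1\<close>-translate of \<open>f\<^sub>2\<close>.\<close>

definition wreath_product ::
  "('a, 'm) monoid_scheme \<Rightarrow> ('h, 'n) monoid_scheme \<Rightarrow> (('h \<Rightarrow> 'a) \<times> 'h) monoid" where
  "wreath_product G H =
     \<lparr>carrier = fin_supp_maps G H \<times> carrier H,
      monoid.mult = (\<lambda>(f1, h1) (f2, h2).
        ((\<lambda>y\<in>carrier H. f1 y \<otimes>\<^bsub>G\<^esub> shift_map H h1 f2 y), h1 \<otimes>\<^bsub>H\<^esub> h2)),
      monoid.one = ((\<lambda>y\<in>carrier H. \<one>\<^bsub>G\<^esub>), \<one>\<^bsub>H\<^esub>)\<rparr>"


section \<open>Generating sets and words\<close>

definition finitely_generated :: "('a, 'm) monoid_scheme \<Rightarrow> bool" where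
  "finitely_generated G \<longleftrightarrow> (\<exists>A. finite A \<and> A \<subseteq> carrier G \<and> generate G A = carrier G)"

text \<open>The homomorphism from the free group on \<open>S\<close> to \<open>G\<close> that extends \<open>\<iota>\<close> is surjective iff the
  image \<open>\<iota> ` S\<close> generates \<open>G\<close>; \<open>\<iota>\<close> need not be injective.\<close>

definition std_generators :: "('a, 'm) monoid_scheme \<Rightarrow> 's set \<Rightarrow> ('s \<Rightarrow> 'a) \<Rightarrow> bool" where
  "std_generators G S \<iota> \<longleftrightarrow> finite S \<and> \<iota> ` S \<subseteq> carrier G \<and> generate G (\<iota> ` S) = carrier G"

text \<open>\<open>\<Sigma> = S \<union> S\<^sup>-\<^sup>1 \<union> {1}\<close> is a set of formal letters.\<close>

datatype 's letter = Unit | Gen 's | InvGen 's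

definition std_alphabet :: "'s set \<Rightarrow> 's letter set" where
  "std_alphabet S = {Unit} \<union> Gen ` S \<union> InvGen ` S"

fun letter_inv :: "'s letter \<Rightarrow> 's letter" where
  "letter_inv Unit = Unit"
| "letter_inv (Gen s) = InvGen s"
| "letter_inv (InvGen s) = Gen s"

definition word_inv :: "'s letter list \<Rightarrow> 's letter list" where
  "word_inv w = rev (map letter_inv w)"

definition word_comm :: "'s letter list \<Rightarrow> 's letter list \<Rightarrow> 's letter list" where
  "word_comm h g = word_inv h @ word_inv g @ h @ g"

fun letter_eval :: "('a, 'm) monoid_scheme \<Rightarrow> ('s \<Rightarrow> 'a) \<Rightarrow> 's letter \<Rightarrow> 'a" where
  "letter_eval G \<iota> Unit = \<one>\<^bsub>G\<^esub>"
| "letter_eval G \<iota> (Gen s) = \<iota> s"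
| "letter_eval G \<iota> (InvGen s) = inv\<^bsub>G\<^esub> (\<iota> s)"

definition word_eval :: "('a, 'm) monoid_scheme \<Rightarrow> ('s \<Rightarrow> 'a) \<Rightarrow> 's letter list \<Rightarrow> 'a" where
  "word_eval G \<iota> w = foldr (\<lambda>a x. letter_eval G \<iota> a \<otimes>\<^bsub>G\<^esub> x) w \<one>\<^bsub>G\<^esub>"


section \<open>Deterministic linear time on random access Turing machines\<close>

text \<open>Deterministic multitape machines in the style of Barrington, Immerman and Straubing.  The
  input is read-only; at each step the machine sees the input symbol whose (0-based) position is
  written in binary on tape 0, the address tape, or \<^const>\<open>None\<close> if there is no such position.
  All tapes, including the address tape, are read-write and one-way infinite.  States, tape symbols
  and tapes are initial segments of the naturals, and tape symbol 0 is the blank.\<close>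

datatype move = MoveL | Stay | MoveR

record 'i ratm =
  num_states :: nat
  num_symbols :: nat
  num_tapes :: nat
  start_state :: nat
  acc_state :: nat
  rej_state :: nat
  trans :: "nat \<Rightarrow> 'i option \<Rightarrow> nat list \<Rightarrow> nat \<times> (nat \<times> move) list"

text \<open>Only the arguments of \<^const>\<open>trans\<close> constrained below can occur in a run on an input over
  \<open>A\<close>, so for finite \<open>A\<close> the transition function is a finite table.\<close>

definition wf_ratm :: "'i set \<Rightarrow> 'i ratm \<Rightarrow> bool" where
  "wf_ratm A M \<longleftrightarrow>
     num_tapes M \<ge> 1 \<and> num_symbols M \<ge> 2 \<and>
     start_state M < num_states M \<and> acc_state M < num_states M \<and> rej_state M < num_states M \<and>
     acc_state M \<noteq> rej_state M \<and>
     (\<forall>q x rs. q < num_states M \<longrightarrow> x \<in> {None} \<union> Some ` A \<longrightarrow>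
        length rs = num_tapes M \<longrightarrow> set rs \<subseteq> {..<num_symbols M} \<longrightarrow>
        (case trans M q x rs of (q', acts) \<Rightarrow>
           q' < num_states M \<and> length acts = num_tapes M \<and> fst ` set acts \<subseteq> {..<num_symbols M}))"

text \<open>A tape is a pair of a head position and the cell contents.\<close>

type_synonym tape = "nat \<times> (nat \<Rightarrow> nat)"

type_synonym ratm_config = "nat \<times> tape list"

definition read_tape :: "tape \<Rightarrow> nat" where
  "read_tape t = snd t (fst t)"

text \<open>Moving left in cell 0 leaves the head in place.\<close>

fun move_head :: "move \<Rightarrow> nat \<Rightarrow> nat" where
  "move_head MoveL p = p - 1"
| "move_head Stay p = p"
| "move_head MoveR p = p + 1"

definition act_tape :: "nat \<times> move \<Rightarrow> tape \<Rightarrow> tape" where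
  "act_tape a t = (move_head (snd a) (fst t), (snd t)(fst t := fst a))"

text \<open>Cell \<open>j\<close> of the address tape carries the bit of weight \<open>2 ^ j\<close>: symbol 1 is the bit 1, and
  any other symbol, in particular the blank, is the bit 0.  In every reachable configuration only
  finitely many cells are non-blank, so the sum is finite.\<close>

definition address :: "tape \<Rightarrow> nat" where
  "address t = (\<Sum>j | snd t j = 1. 2 ^ j)"

definition query_input :: "'i list \<Rightarrow> nat \<Rightarrow> 'i option" where
  "query_input x n = (if n < length x then Some (x ! n) else None)"

definition ratm_init :: "'i ratm \<Rightarrow> ratm_config" where
  "ratm_init M = (start_state M, replicate (num_tapes M) (0, \<lambda>_. 0))"

definition ratm_step :: "'i ratm \<Rightarrow> 'i list \<Rightarrow> ratm_config \<Rightarrow> ratm_config" where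
  "ratm_step M x c =
     (case c of (q, ts) \<Rightarrow>
        if q = acc_state M \<or> q = rej_state M then c
        else case trans M q (query_input x (address (hd ts))) (map read_tape ts) of
          (q', acts) \<Rightarrow> (q', map2 act_tape acts ts))"

definition ratm_run :: "'i ratm \<Rightarrow> 'i list \<Rightarrow> nat \<Rightarrow> ratm_config" where
  "ratm_run M x t = (ratm_step M x ^^ t) (ratm_init M)"

text \<open>The languages over the finite alphabet \<open>A\<close> decidable in deterministic linear time.  The
  halting states are absorbing, so halting within \<open>t\<close> steps is being in one of them after \<open>t\<close>
  steps.\<close>

definition DLINTIME :: "'i set \<Rightarrow> 'i list set set" where
  "DLINTIME A =
     {L. finite A \<and> L \<subseteq> lists A \<and>
        (\<exists>M c. wf_ratm A M \<and>
           (\<forall>x\<in>lists A. fst (ratm_run M x (c * (length x + 1))) =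
              (if x \<in> L then acc_state M else rej_state M)))}"


section \<open>Uniformly strongly efficiently non-solvable groups\<close>

text \<open>Conditions (a)--(c).  Only the words \<open>g d v\<close> with \<open>length v \<le> d\<close> are relevant.\<close>

definition sens_words ::
  "('a, 'm) monoid_scheme \<Rightarrow> 's set \<Rightarrow> ('s \<Rightarrow> 'a) \<Rightarrow> nat \<Rightarrow> (nat \<Rightarrow> bool list \<Rightarrow> 's letter list) \<Rightarrow> bool"
where
  "sens_words G S \<iota> \<mu> g \<longleftrightarrow>
     (\<forall>d.
        (\<forall>v. length v \<le> d \<longrightarrow> set (g d v) \<subseteq> std_alphabet S) \<and>
        (\<forall>v. length v = d \<longrightarrow> length (g d v) = 2 ^ (\<mu> * d)) \<and>
        (\<forall>v. length v < d \<longrightarrow> g d v = word_comm (g d (v @ [False])) (g d (v @ [True]))) \<and>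
        word_eval G \<iota> (g d []) \<noteq> \<one>\<^bsub>G\<^esub>)"

text \<open>The triple \<open>(v, i, a)\<close> is presented as \<open>v # i # a\<close> with a separator \<open>#\<close>, where \<open>i\<close> is written
  with its most significant bit first.\<close>

datatype 's insym = Bit bool | Sep | Letter "'s letter"

definition query_alphabet :: "'s set \<Rightarrow> 's insym set" where
  "query_alphabet S = range Bit \<union> {Sep} \<union> Letter ` std_alphabet S"

definition encode_query :: "bool list \<Rightarrow> bool list \<Rightarrow> 's letter \<Rightarrow> 's insym list" where
  "encode_query v bs a = map Bit v @ [Sep] @ map Bit bs @ [Sep] @ [Letter a]"

definition binary_value :: "bool list \<Rightarrow> nat" where
  "binary_value bs = horner_sum of_bool 2 (rev bs)"

text \<open>With \<open>\<mu> * d\<close> bits one writes exactly the numbers \<open>0, \<dots>, 2 ^ (\<mu> * d) - 1\<close>; accordingly the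
  letters of \<open>g d v\<close> are numbered from 0.\<close>

definition letter_language ::
  "'s set \<Rightarrow> nat \<Rightarrow> (nat \<Rightarrow> bool list \<Rightarrow> 's letter list) \<Rightarrow> 's insym list set" where
  "letter_language S \<mu> g =
     {encode_query v bs a | d v bs a.
        length v = d \<and> length bs = \<mu> * d \<and> a \<in> std_alphabet S \<and> g d v ! binary_value bs = a}"

definition uniformly_SENS_wrt :: "('a, 'm) monoid_scheme \<Rightarrow> 's set \<Rightarrow> ('s \<Rightarrow> 'a) \<Rightarrow> bool" where
  "uniformly_SENS_wrt G S \<iota> \<longleftrightarrow>
     (\<exists>\<mu> g. sens_words G S \<iota> \<mu> g \<and> letter_language S \<mu> g \<in> DLINTIME (query_alphabet S))"

text \<open>The property does not depend on the generating set; it is required for all of them.  Every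
  finite set is in bijection with a set of naturals, so it suffices to index generators by
  naturals.\<close>

definition uniformly_SENS :: "('a, 'm) monoid_scheme \<Rightarrow> bool" where
  "uniformly_SENS G \<longleftrightarrow>
     finitely_generated G \<and>
     (\<forall>(S :: nat set) \<iota>. std_generators G S \<iota> \<longrightarrow> uniformly_SENS_wrt G S \<iota>)"

end

theory Submission
  imports Defs
begin

text \<open>Fix an embedding of \<open>G \<wr> H\<close> into \<open>G\<close> and let \<open>\<sigma>\<close> be its restriction to the copy of \<open>G\<close> at
  position \<open>1\<close> of the base group, and \<open>t\<close> the image of some \<open>h \<noteq> 1\<close> in \<open>H\<close>.  For \<open>g\<close> in \<open>G\<close> the
  commutator \<open>[t, \<sigma> g]\<close> lies in the base group and has the value \<open>g\<close> at position \<open>1\<close>.  So if the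
  leaves at depth \<open>d + 1\<close> are \<open>g\<^bsub>d+1,v0\<^esub> = t\<close> and \<open>g\<^bsub>d+1,v1\<^esub> = \<sigma> g\<^bsub>d,v\<^esub>\<close>, then \<open>g\<^bsub>d+1,v\<^esub>\<close> has the
  value \<open>g\<^bsub>d,v\<^esub>\<close> at \<open>1\<close> for all \<open>v\<close> of length at most \<open>d\<close>, and nested commutators never become
  trivial.

  On words \<open>\<sigma>\<close> is a substitution of letters by words, which by padding with the letter \<open>1\<close> all have
  the length \<open>2 ^ \<mu>\<close>.  Hence a finite automaton that reads \<open>v\<close> and the position \<open>i\<close> in parallel, one bit
  of \<open>v\<close> per \<open>\<mu>\<close> bits of \<open>i\<close>, computes the \<open>i\<close>-th letter.  A random access machine simulates it
  after copying \<open>v\<close> to a work tape; it reads the input from left to right by incrementing the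
  address, which takes amortised constant time per increment.\<close>

section \<open>Evaluating words\<close>

lemma set_word_inv: "set w \<subseteq> std_alphabet S \<Longrightarrow> set (word_inv w) \<subseteq> std_alphabet S"
  by (auto simp: word_inv_def std_alphabet_def)

context group
begin

lemma letter_eval_closed:
  "\<lbrakk>\<iota> ` S \<subseteq> carrier G; a \<in> std_alphabet S\<rbrakk> \<Longrightarrow> letter_eval G \<iota> a \<in> carrier G"
  by (auto simp: std_alphabet_def)

lemma letter_eval_inv:
  "\<lbrakk>\<iota> ` S \<subseteq> carrier G; a \<in> std_alphabet S\<rbrakk>
    \<Longrightarrow> letter_eval G \<iota> (letter_inv a) = inv (letter_eval G \<iota> a)"
  by (auto simp: std_alphabet_def)

lemma word_eval_simps [simp]:
  "word_eval G \<iota> [] = \<one>"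
  "word_eval G \<iota> (a # w) = letter_eval G \<iota> a \<otimes> word_eval G \<iota> w"
  by (simp_all add: word_eval_def)

lemma word_eval_closed:
  "\<lbrakk>\<iota> ` S \<subseteq> carrier G; set w \<subseteq> std_alphabet S\<rbrakk> \<Longrightarrow> word_eval G \<iota> w \<in> carrier G"
  by (induction w) (auto simp: letter_eval_closed)

lemma word_eval_append:
  assumes "\<iota> ` S \<subseteq> carrier G" "set u \<subseteq> std_alphabet S" "set w \<subseteq> std_alphabet S"
  shows "word_eval G \<iota> (u @ w) = word_eval G \<iota> u \<otimes> word_eval G \<iota> w"
  using assms(2)
  by (induction u) (auto simp: m_assoc letter_eval_closed[OF assms(1)] word_eval_closed[OF assms(1)] assms(3))

lemma word_eval_word_inv:
  assumes "\<iota> ` S \<subseteq> carrier G" "set w \<subseteq> std_alphabet S"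
  shows "word_eval G \<iota> (word_inv w) = inv (word_eval G \<iota> w)"
  using assms(2)
proof (induction w)
  case Nil
  then show ?case by (simp add: word_inv_def)
next
  case (Cons a w)
  then have "set [letter_inv a] \<subseteq> std_alphabet S" "set (word_inv w) \<subseteq> std_alphabet S"
    using set_word_inv[of "[a]" S] set_word_inv[of w S] by (simp_all add: word_inv_def)
  then have "word_eval G \<iota> (word_inv w @ [letter_inv a]) =
      word_eval G \<iota> (word_inv w) \<otimes> word_eval G \<iota> [letter_inv a]"
    by (intro word_eval_append[OF assms(1)])
  then show ?case
    using Cons letter_eval_closed[OF assms(1), of a] word_eval_closed[OF assms(1), of w]
    by (simp add: word_inv_def letter_eval_inv[OF assms(1)] inv_mult_group)
qed

lemma word_eval_word_comm:
  assumes "\<iota> ` S \<subseteq> carrier G" "set u \<subseteq> std_alphabet S" "set w \<subseteq> std_alphabet S"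
  shows "word_eval G \<iota> (word_comm u w) =
    inv (word_eval G \<iota> u) \<otimes> (inv (word_eval G \<iota> w) \<otimes> (word_eval G \<iota> u \<otimes> word_eval G \<iota> w))"
  using assms set_word_inv[of u S] set_word_inv[of w S]
  by (simp add: word_comm_def word_eval_append[where S = S] word_eval_word_inv[where S = S])

lemma word_eval_replicate_Unit [simp]: "word_eval G \<iota> (replicate n Unit) = \<one>"
  by (induction n) simp_all

section \<open>Spelling group elements by words of a prescribed length\<close>

lemma ex_word_eval:
  assumes "std_generators G S \<iota>" and "x \<in> carrier G"
  shows "\<exists>w. set w \<subseteq> std_alphabet S \<and> word_eval G \<iota> w = x"
proof -
  have gen: "\<iota> ` S \<subseteq> carrier G" "x \<in> generate G (\<iota> ` S)"
    using assms by (auto simp: std_generators_def)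
  from gen(2) show ?thesis
  proof induction
    case one
    show ?case by (intro exI[of _ "[]"]) simp
  next
    case (incl y)
    then obtain s where "s \<in> S" "y = \<iota> s" by blast
    then show ?case using gen by (intro exI[of _ "[Gen s]"]) (auto simp: std_alphabet_def)
  next
    case (inv y)
    then obtain s where "s \<in> S" "y = \<iota> s" by blast
    then show ?case using gen by (intro exI[of _ "[InvGen s]"]) (auto simp: std_alphabet_def)
  next
    case (eng y z)
    then obtain u w where "set u \<subseteq> std_alphabet S" "word_eval G \<iota> u = y"
      "set w \<subseteq> std_alphabet S" "word_eval G \<iota> w = z" by blast
    then show ?case using word_eval_append[OF gen(1)] by (intro exI[of _ "u @ w"]) auto
  qed
qed

text \<open>Padding with the letter \<open>Unit\<close> does not change the value of a word. A
  common length that is a power of 2 makes a position in a substituted word split into blocks of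
  \<open>\<mu>\<close> bits.\<close>

lemma ex_words_of_equal_length:
  assumes S: "std_generators G S \<iota>" and X: "finite X" "X \<subseteq> carrier G"
  shows "\<exists>\<mu>>0. \<forall>x\<in>X. \<exists>w. set w \<subseteq> std_alphabet S \<and> length w = 2 ^ \<mu> \<and> word_eval G \<iota> w = x"
proof -
  have "\<forall>x\<in>X. \<exists>w. set w \<subseteq> std_alphabet S \<and> word_eval G \<iota> w = x"
    using ex_word_eval[OF S] X by blast
  then obtain w where w: "\<And>x. x \<in> X \<Longrightarrow> set (w x) \<subseteq> std_alphabet S \<and> word_eval G \<iota> (w x) = x"
    by metis
  \<comment> \<open>The sum bounds every length, \<open>n < 2 ^ n\<close> then leaves room for the
    padding, and \<open>Suc\<close> makes \<open>\<mu>\<close> positive.\<close>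
  define \<mu> where "\<mu> = Suc (\<Sum>x\<in>X. length (w x))"
  have "\<exists>w'. set w' \<subseteq> std_alphabet S \<and> length w' = 2 ^ \<mu> \<and> word_eval G \<iota> w' = x" if "x \<in> X" for x
  proof -
    have "length (w x) \<le> \<mu>"
      using member_le_sum[of x X "\<lambda>x. length (w x)"] X that by (simp add: \<mu>_def)
    then have "length (w x) \<le> 2 ^ \<mu>"
      using less_exp[of \<mu>] by linarith
    moreover have rep: "set (replicate n Unit) \<subseteq> std_alphabet S" for n
      by (auto simp: std_alphabet_def)
    moreover have "word_eval G \<iota> (w x @ replicate n Unit) = x" for n
      using word_eval_append[of \<iota> S "w x" "replicate n Unit"] w[OF that] S rep[of n] X that
      by (auto simp: std_generators_def)
    ultimately show ?thesis
      using w[OF that] by (intro exI[of _ "w x @ replicate (2 ^ \<mu> - length (w x)) Unit"]) auto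
  qed
  then show ?thesis by (intro exI[of _ \<mu>]) (simp add: \<mu>_def)
qed

text \<open>At depth 0 the only word has length \<open>2 ^ 0 = 1\<close>, so non-triviality has to
  start from a single letter.\<close>

lemma ex_nontrivial_letter:
  assumes "std_generators G S \<iota>" and "carrier G \<noteq> {\<one>}"
  shows "\<exists>a\<in>std_alphabet S. letter_eval G \<iota> a \<noteq> \<one>"
proof (rule ccontr)
  assume "\<not> ?thesis"
  then have "set w \<subseteq> std_alphabet S \<Longrightarrow> word_eval G \<iota> w = \<one>" for w
    by (induction w) auto
  then have "carrier G \<subseteq> {\<one>}" using ex_word_eval[OF assms(1)] by blast
  then show False using assms(2) by blast
qed

end


section \<open>Embedded wreath products\<close>

lemma fin_supp_mapsI:
  assumes "\<And>y. y \<in> carrier H \<Longrightarrow> f y \<in> carrier G"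
    and "finite B" and "\<And>y. \<lbrakk>y \<in> carrier H; y \<notin> B\<rbrakk> \<Longrightarrow> f y = \<one>\<^bsub>G\<^esub>"
  shows "(\<lambda>y\<in>carrier H. f y) \<in> fin_supp_maps G H"
proof -
  have "finite {y \<in> carrier H. f y \<noteq> \<one>\<^bsub>G\<^esub>}"
    by (rule finite_subset[OF _ assms(2)]) (use assms(3) in blast)
  then show ?thesis
    using assms(1) by (simp add: fin_supp_maps_def cong: conj_cong)
qed

text \<open>Here \<open>\<sigma>\<close> embeds \<open>G\<close> as the copy of \<open>G\<close> at position \<open>1\<close> of the base group, \<open>t\<close> is the image
  of a non-trivial element \<open>h\<close> of \<open>H\<close>, and \<open>P x g\<close> says that \<open>x\<close> is the image of an element of the
  base group with value \<open>g\<close> at position \<open>1\<close>.  The commutator \<open>[t, \<sigma> g]\<close> has the value \<open>g\<close> at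
  \<open>1\<close>, since the factor \<open>t\<^sup>-\<^sup>1 (\<sigma> g)\<^sup>-\<^sup>1 t\<close> is concentrated at \<open>h\<close>.\<close>

lemma wreath_embedding:
  fixes G :: "('a, 'm) monoid_scheme" and H :: "('h, 'n) monoid_scheme"
  assumes "group G" and "group H" and h: "h \<in> carrier H" "h \<noteq> \<one>\<^bsub>H\<^esub>"
    and \<phi>: "\<phi> \<in> hom (wreath_product G H) G" "inj_on \<phi> (carrier (wreath_product G H))"
  obtains \<sigma> t P where
    "\<sigma> \<in> hom G G" and "t \<in> carrier G" and "t \<noteq> \<one>\<^bsub>G\<^esub>"
    and "\<And>g. P \<one>\<^bsub>G\<^esub> g \<Longrightarrow> g = \<one>\<^bsub>G\<^esub>"
    and "\<And>x y g k. \<lbrakk>P x g; P y k\<rbrakk> \<Longrightarrow> P (x \<otimes>\<^bsub>G\<^esub> y) (g \<otimes>\<^bsub>G\<^esub> k)"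
    and "\<And>x g. P x g \<Longrightarrow> P (inv\<^bsub>G\<^esub> x) (inv\<^bsub>G\<^esub> g)"
    and "\<And>g. g \<in> carrier G \<Longrightarrow> P (inv\<^bsub>G\<^esub> t \<otimes>\<^bsub>G\<^esub> (inv\<^bsub>G\<^esub> (\<sigma> g) \<otimes>\<^bsub>G\<^esub> (t \<otimes>\<^bsub>G\<^esub> \<sigma> g))) g"
proof -
  interpret G: group G by fact
  interpret H: group H by fact
  let ?W = "wreath_product G H"
  let ?F = "fin_supp_maps G H"
  define e where "e = (\<lambda>y\<in>carrier H. \<one>\<^bsub>G\<^esub>)"
  define single where "single g = (\<lambda>y\<in>carrier H. if y = \<one>\<^bsub>H\<^esub> then g else \<one>\<^bsub>G\<^esub>)" for g
  define P where "P x g \<longleftrightarrow> (\<exists>f\<in>?F. x = \<phi> (f, \<one>\<^bsub>H\<^esub>) \<and> g = f \<one>\<^bsub>H\<^esub>)" for x g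
  have F: "f y \<in> carrier G" if "f \<in> ?F" "y \<in> carrier H" for f y
    using that by (auto simp: fin_supp_maps_def)
  have supp: "finite {y \<in> carrier H. f y \<noteq> \<one>\<^bsub>G\<^esub>}" if "f \<in> ?F" for f
    using that by (auto simp: fin_supp_maps_def)
  have carr: "(f, k) \<in> carrier ?W \<longleftrightarrow> f \<in> ?F \<and> k \<in> carrier H" for f k
    by (simp add: wreath_product_def)
  have e_in: "e \<in> ?F" unfolding e_def by (rule fin_supp_mapsI[of _ _ _ "{}"]) auto
  have single_in: "single g \<in> ?F" if "g \<in> carrier G" for g
    unfolding single_def by (rule fin_supp_mapsI[of _ _ _ "{\<one>\<^bsub>H\<^esub>}"]) (use that in auto)
  have mult: "\<phi> (f1, h1) \<otimes>\<^bsub>G\<^esub> \<phi> (f2, h2) =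
      \<phi> (\<lambda>y\<in>carrier H. f1 y \<otimes>\<^bsub>G\<^esub> f2 (y \<otimes>\<^bsub>H\<^esub> h1), h1 \<otimes>\<^bsub>H\<^esub> h2)"
    if "f1 \<in> ?F" "f2 \<in> ?F" "h1 \<in> carrier H" "h2 \<in> carrier H" for f1 f2 h1 h2
  proof -
    have "(f1, h1) \<otimes>\<^bsub>?W\<^esub> (f2, h2) =
        (\<lambda>y\<in>carrier H. f1 y \<otimes>\<^bsub>G\<^esub> f2 (y \<otimes>\<^bsub>H\<^esub> h1), h1 \<otimes>\<^bsub>H\<^esub> h2)"
      by (auto simp: wreath_product_def shift_map_def restrict_def)
    then show ?thesis using hom_mult[OF \<phi>(1), of "(f1, h1)" "(f2, h2)"] that by (simp add: carr)
  qed
  have closed: "\<phi> (f, k) \<in> carrier G" if "f \<in> ?F" "k \<in> carrier H" for f k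
    using hom_in_carrier[OF \<phi>(1), of "(f, k)"] that by (simp add: carr)
  \<comment> \<open>The image of the identity is idempotent, and an idempotent of a group is
    trivial.\<close>
  have "\<phi> (e, \<one>\<^bsub>H\<^esub>) \<otimes>\<^bsub>G\<^esub> \<phi> (e, \<one>\<^bsub>H\<^esub>) = \<phi> (e, \<one>\<^bsub>H\<^esub>)"
    using e_in by (subst mult) (auto simp: e_def restrict_def cong: if_cong)
  then have one: "\<phi> (e, \<one>\<^bsub>H\<^esub>) = \<one>\<^bsub>G\<^esub>"
    using closed[OF e_in H.one_closed] by (simp add: G.l_cancel_one)
  have mult_in: "(\<lambda>y\<in>carrier H. f1 y \<otimes>\<^bsub>G\<^esub> f2 y) \<in> ?F" if "f1 \<in> ?F" "f2 \<in> ?F" for f1 f2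
    by (rule fin_supp_mapsI[of _ _ _ "{y \<in> carrier H. f1 y \<noteq> \<one>\<^bsub>G\<^esub>} \<union> {y \<in> carrier H. f2 y \<noteq> \<one>\<^bsub>G\<^esub>}"])
      (use that F supp in auto)
  have inv_in: "(\<lambda>y\<in>carrier H. inv\<^bsub>G\<^esub> f y) \<in> ?F" if "f \<in> ?F" for f
    by (rule fin_supp_mapsI[of _ _ _ "{y \<in> carrier H. f y \<noteq> \<one>\<^bsub>G\<^esub>}"]) (use that F supp in auto)
  have base_mult: "\<phi> (f1, \<one>\<^bsub>H\<^esub>) \<otimes>\<^bsub>G\<^esub> \<phi> (f2, \<one>\<^bsub>H\<^esub>) = \<phi> (\<lambda>y\<in>carrier H. f1 y \<otimes>\<^bsub>G\<^esub> f2 y, \<one>\<^bsub>H\<^esub>)"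
    if "f1 \<in> ?F" "f2 \<in> ?F" for f1 f2
    using that by (subst mult) (auto simp: restrict_def cong: if_cong)
  define \<sigma> where "\<sigma> g = \<phi> (single g, \<one>\<^bsub>H\<^esub>)" for g
  define t where "t = \<phi> (e, h)"
  show thesis
  proof (rule that[of \<sigma> t P])
    show "\<sigma> \<in> hom G G"
    proof (rule homI)
      fix g k assume "g \<in> carrier G" "k \<in> carrier G"
      then show "\<sigma> g \<in> carrier G" "\<sigma> (g \<otimes>\<^bsub>G\<^esub> k) = \<sigma> g \<otimes>\<^bsub>G\<^esub> \<sigma> k"
        by (auto simp: \<sigma>_def closed single_in base_mult)
          (auto simp: single_def restrict_def intro!: arg_cong[where f = \<phi>])
    qed
    show "t \<in> carrier G" using closed e_in h by (simp add: t_def)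
    show "t \<noteq> \<one>\<^bsub>G\<^esub>"
      using inj_onD[OF \<phi>(2), of "(e, h)" "(e, \<one>\<^bsub>H\<^esub>)"] e_in h by (auto simp: t_def carr simp flip: one)
    show "g = \<one>\<^bsub>G\<^esub>" if P1: "P \<one>\<^bsub>G\<^esub> g" for g
    proof -
      obtain f where "f \<in> ?F" "\<phi> (f, \<one>\<^bsub>H\<^esub>) = \<phi> (e, \<one>\<^bsub>H\<^esub>)" "g = f \<one>\<^bsub>H\<^esub>"
        using P1 one by (auto simp: P_def)
      then show ?thesis
        using inj_onD[OF \<phi>(2), of "(f, \<one>\<^bsub>H\<^esub>)" "(e, \<one>\<^bsub>H\<^esub>)"] e_in by (auto simp: carr e_def)
    qed
    show "P (x \<otimes>\<^bsub>G\<^esub> y) (g \<otimes>\<^bsub>G\<^esub> k)" if Pxy: "P x g" "P y k" for x y g k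
    proof -
      obtain f1 f2 where "f1 \<in> ?F" "f2 \<in> ?F" "x = \<phi> (f1, \<one>\<^bsub>H\<^esub>)" "y = \<phi> (f2, \<one>\<^bsub>H\<^esub>)"
        "g = f1 \<one>\<^bsub>H\<^esub>" "k = f2 \<one>\<^bsub>H\<^esub>"
        using Pxy by (auto simp: P_def)
      then show ?thesis
        unfolding P_def by (intro bexI[OF _ mult_in[of f1 f2]]) (auto simp: base_mult)
    qed
    show "P (inv\<^bsub>G\<^esub> x) (inv\<^bsub>G\<^esub> g)" if Px: "P x g" for x g
    proof -
      obtain f where f: "f \<in> ?F" "x = \<phi> (f, \<one>\<^bsub>H\<^esub>)" "g = f \<one>\<^bsub>H\<^esub>"
        using Px by (auto simp: P_def)
      have "(\<lambda>y\<in>carrier H. (\<lambda>y\<in>carrier H. inv\<^bsub>G\<^esub> f y) y \<otimes>\<^bsub>G\<^esub> f y) = e"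
        using F[OF f(1)] by (auto simp: e_def restrict_def)
      then have "\<phi> (\<lambda>y\<in>carrier H. inv\<^bsub>G\<^esub> f y, \<one>\<^bsub>H\<^esub>) \<otimes>\<^bsub>G\<^esub> x = \<one>\<^bsub>G\<^esub>"
        using base_mult[OF inv_in[OF f(1)] f(1)] f(2) one by simp
      then have "inv\<^bsub>G\<^esub> x = \<phi> (\<lambda>y\<in>carrier H. inv\<^bsub>G\<^esub> f y, \<one>\<^bsub>H\<^esub>)"
        using closed inv_in f by (intro G.inv_equality) auto
      then show ?thesis
        unfolding P_def using f by (intro bexI[OF _ inv_in[OF f(1)]]) auto
    qed
    show "P (inv\<^bsub>G\<^esub> t \<otimes>\<^bsub>G\<^esub> (inv\<^bsub>G\<^esub> (\<sigma> g) \<otimes>\<^bsub>G\<^esub> (t \<otimes>\<^bsub>G\<^esub> \<sigma> g))) g" if g: "g \<in> carrier G" for g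
    proof -
      \<comment> \<open>This is the base component of \<open>[t, \<sigma> g]\<close>: conjugating
        \<open>(\<sigma> g)\<close> inverse by \<open>t\<close> moves its support from
        \<open>\<one>\<close> to \<open>h\<close>. So \<open>f\<close> has value \<open>g\<close> at
        \<open>\<one>\<close>, the inverse of \<open>g\<close> at \<open>h\<close>, and is trivial
        elsewhere.\<close>
      define f where "f = (\<lambda>y\<in>carrier H. inv\<^bsub>G\<^esub> (single g (y \<otimes>\<^bsub>H\<^esub> inv\<^bsub>H\<^esub> h)) \<otimes>\<^bsub>G\<^esub> single g y)"
      have f_in: "f \<in> ?F"
        unfolding f_def
      proof (rule fin_supp_mapsI[of _ _ _ "{\<one>\<^bsub>H\<^esub>, h}"])
        fix y assume y: "y \<in> carrier H"
        then show "inv\<^bsub>G\<^esub> (single g (y \<otimes>\<^bsub>H\<^esub> inv\<^bsub>H\<^esub> h)) \<otimes>\<^bsub>G\<^esub> single g y \<in> carrier G"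
          using F[OF single_in[OF g]] h by simp
        assume "y \<notin> {\<one>\<^bsub>H\<^esub>, h}"
        moreover have "y \<otimes>\<^bsub>H\<^esub> inv\<^bsub>H\<^esub> h = \<one>\<^bsub>H\<^esub> \<Longrightarrow> y = h"
          using y h by (metis H.inv_closed H.inv_equality H.inv_inv)
        ultimately show "inv\<^bsub>G\<^esub> (single g (y \<otimes>\<^bsub>H\<^esub> inv\<^bsub>H\<^esub> h)) \<otimes>\<^bsub>G\<^esub> single g y = \<one>\<^bsub>G\<^esub>"
          using y h by (auto simp: single_def)
      qed simp
      \<comment> \<open>As \<open>h \<noteq> \<one>\<close>, the conjugated factor is trivial at
        position \<open>\<one>\<close>.\<close>
      have f1: "f \<one>\<^bsub>H\<^esub> = g"
        using h g by (auto simp: f_def single_def H.inv_eq_1_iff)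
      have s: "\<sigma> g \<in> carrier G" and t: "t \<in> carrier G"
        using closed single_in g e_in h by (auto simp: \<sigma>_def t_def)
      have st: "\<sigma> g \<otimes>\<^bsub>G\<^esub> t = \<phi> (single g, h)"
        using single_in[OF g] e_in h g F[OF single_in[OF g]] unfolding \<sigma>_def t_def
        by (subst mult) (auto simp: e_def single_def fun_eq_iff intro!: arg_cong[where f = \<phi>])
      \<comment> \<open>The commutator identity in the form
        \<open>\<sigma> g * t * [t, \<sigma> g] = t * \<sigma> g\<close>, which can be checked
        pointwise without inverses in the wreath product.\<close>
      have "\<phi> (single g, h) \<otimes>\<^bsub>G\<^esub> \<phi> (f, \<one>\<^bsub>H\<^esub>) = t \<otimes>\<^bsub>G\<^esub> \<sigma> g"
      proof -
        have "single g y \<otimes>\<^bsub>G\<^esub> f (y \<otimes>\<^bsub>H\<^esub> h) = single g (y \<otimes>\<^bsub>H\<^esub> h)" if y: "y \<in> carrier H" for y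
        proof -
          have "y \<otimes>\<^bsub>H\<^esub> h \<otimes>\<^bsub>H\<^esub> inv\<^bsub>H\<^esub> h = y" using y h by (simp add: H.m_assoc)
          then have "f (y \<otimes>\<^bsub>H\<^esub> h) = inv\<^bsub>G\<^esub> (single g y) \<otimes>\<^bsub>G\<^esub> single g (y \<otimes>\<^bsub>H\<^esub> h)"
            using y h by (simp add: f_def)
          then show ?thesis
            using F[OF single_in[OF g]] y h by (simp add: G.m_assoc[symmetric])
        qed
        moreover have "e y \<otimes>\<^bsub>G\<^esub> single g (y \<otimes>\<^bsub>H\<^esub> h) = single g (y \<otimes>\<^bsub>H\<^esub> h)" if y: "y \<in> carrier H" for y
          using F[OF single_in[OF g]] y h by (simp add: e_def)
        ultimately show ?thesis
          using single_in[OF g] e_in f_in h unfolding \<sigma>_def t_def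
          by (simp add: mult cong: restrict_cong)
      qed
      then have "\<phi> (f, \<one>\<^bsub>H\<^esub>) = inv\<^bsub>G\<^esub> (\<sigma> g \<otimes>\<^bsub>G\<^esub> t) \<otimes>\<^bsub>G\<^esub> (t \<otimes>\<^bsub>G\<^esub> \<sigma> g)"
        using closed[OF f_in H.one_closed] s t
        by (simp add: st[symmetric]) (metis G.inv_solve_left G.m_closed)
      also have "\<dots> = inv\<^bsub>G\<^esub> t \<otimes>\<^bsub>G\<^esub> (inv\<^bsub>G\<^esub> (\<sigma> g) \<otimes>\<^bsub>G\<^esub> (t \<otimes>\<^bsub>G\<^esub> \<sigma> g))"
        using s t by (simp add: G.inv_mult_group G.m_assoc)
      finally show ?thesis
        unfolding P_def using f1 by (intro bexI[OF _ f_in]) auto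
    qed
  qed
qed


section \<open>Reading the input sequentially with one work tape\<close>

text \<open>\<open>Main\<close> performs a step of the simulated automaton; \<open>Carry\<close>
  runs right through the counter and \<open>Return\<close> brings its head back to cell 0.\<close>

datatype mode = Main | Carry | Return

type_synonym 'q seq_config = "'q \<times> tape \<times> nat"

definition ones :: "(nat \<Rightarrow> nat) \<Rightarrow> nat set" where
  "ones f = {j. f j = 1}"

lemma act_tape_read_Stay [simp]: "act_tape (snd t (fst t), Stay) t = t"
  by (cases t) (simp add: act_tape_def)

lemma query_input_in: "x \<in> lists A \<Longrightarrow> query_input x n \<in> {None} \<union> Some ` A"
  by (auto simp: query_input_def in_lists_conv_set)

text \<open>With \<open>m\<close> the length of the initial run of ones, clearing this run loses
  \<open>2 ^ m - 1\<close> and setting cell \<open>m\<close> gains \<open>2 ^ m\<close>. The last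
  equation is the change of potential in the amortised analysis.\<close>

lemma address_increment:
  assumes "finite (ones f)" and m: "f m \<noteq> 1" "\<And>j. j < m \<Longrightarrow> f j = 1"
    and f': "\<And>j. j < m \<Longrightarrow> f' j \<noteq> 1" "f' m = 1" "\<And>j. m < j \<Longrightarrow> f' j = f j"
  shows "finite (ones f') \<and> address (p', f') = address (p, f) + 1 \<and>
    card (ones f') + m = card (ones f) + 1"
proof -
  define R where "R = {j. m < j \<and> f j = 1}"
  have mem: "j \<in> ones f \<longleftrightarrow> j \<in> {..<m} \<union> R" "j \<in> ones f' \<longleftrightarrow> j \<in> insert m R" for j
    using m(1) m(2)[of j] f'(1)[of j] f'(2) f'(3)[of j]
    by (cases j m rule: linorder_cases; simp add: ones_def R_def)+
  have f: "ones f = {..<m} \<union> R" by (rule Set.set_eqI) (rule mem)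
  have g: "ones f' = insert m R" by (rule Set.set_eqI) (rule mem)
  have R: "finite R" "m \<notin> R" "{..<m} \<inter> R = {}"
  proof -
    show "finite R" using assms(1) unfolding f by simp
    show "m \<notin> R" by (simp add: R_def)
    show "{..<m} \<inter> R = {}" unfolding R_def by fastforce
  qed
  have "address (p, f) = (2 ^ m - 1) + (\<Sum>j\<in>R. 2 ^ j)"
    using R f by (simp add: address_def ones_def sum.union_disjoint lessThan_atLeast0 sum_power2)
  moreover have "address (p', f') = 2 ^ m + (\<Sum>j\<in>R. 2 ^ j)"
    using R g by (simp add: address_def ones_def)
  ultimately show ?thesis
    using R f g by (simp add: card_Un_disjoint)
qed

text \<open>An automaton with one work tape whose input position never decreases; the last component
  of \<open>\<delta>\<close> says whether it advances. The work tape shares the four symbols of the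
  counter, hence the bound 4.\<close>

locale seq_machine =
  fixes A :: "'i set" and Q :: "'q set"
    and \<delta> :: "'q \<Rightarrow> 'i option \<Rightarrow> nat \<Rightarrow> 'q \<times> nat \<times> move \<times> bool"
    and q0 qa qr :: 'q
  assumes finite_A: "finite A" and finite_Q: "finite Q"
    and special_states: "q0 \<in> Q" "qa \<in> Q" "qr \<in> Q" "qa \<noteq> qr"
    and \<delta>_closed: "\<And>q x r q' w m adv. \<lbrakk>q \<in> Q; x \<in> {None} \<union> Some ` A; \<delta> q x r = (q', w, m, adv)\<rbrakk>
      \<Longrightarrow> q' \<in> Q \<and> (r < 4 \<longrightarrow> w < 4)"
begin

definition seq_step :: "'i list \<Rightarrow> 'q seq_config \<Rightarrow> 'q seq_config" where
  "seq_step x c = (case c of (q, t, n) \<Rightarrow>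
     if q = qa \<or> q = qr then c
     else case \<delta> q (query_input x n) (read_tape t) of
       (q', w, m, adv) \<Rightarrow> (q', act_tape (w, m) t, n + of_bool adv))"

definition seq_init :: "'q seq_config" where
  "seq_init = (q0, (0, \<lambda>_. 0), 0)"

text \<open>The position in the input is kept as a binary counter on tape 0, whose head rests on cell 0
  between increments.  In an increment the symbol 3, which also stands for the bit 0, is left in
  cell 0 so that the head finds its way back.\<close>

fun ctr_trans :: "'q \<times> mode \<Rightarrow> 'i option \<Rightarrow> nat list \<Rightarrow> ('q \<times> mode) \<times> (nat \<times> move) list" where
  "ctr_trans (q, Main) x rs = (case \<delta> q x (rs ! 1) of (q', w, m, adv) \<Rightarrow>
     if \<not> adv then ((q', Main), [(rs ! 0, Stay), (w, m)])
     else if rs ! 0 = 1 then ((q', Carry), [(3, MoveR), (w, m)])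
     else ((q', Main), [(1, Stay), (w, m)]))"
| "ctr_trans (q, Carry) x rs =
     (if rs ! 0 = 1 then ((q, Carry), [(2, MoveR), (rs ! 1, Stay)])
      else ((q, Return), [(1, MoveL), (rs ! 1, Stay)]))"
| "ctr_trans (q, Return) x rs =
     (if rs ! 0 = 3 then ((q, Main), [(3, Stay), (rs ! 1, Stay)])
      else ((q, Return), [(rs ! 0, MoveL), (rs ! 1, Stay)]))"

section \<open>The binary counter in place of the input position\<close>

definition ctr_step ::
  "'i list \<Rightarrow> ('q \<times> mode) \<times> tape list \<Rightarrow> ('q \<times> mode) \<times> tape list" where
  "ctr_step x c = (case c of (p, ts) \<Rightarrow>
     if p = (qa, Main) \<or> p = (qr, Main) then c
     else case ctr_trans p (query_input x (address (hd ts))) (map read_tape ts) of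
       (p', acts) \<Rightarrow> (p', map2 act_tape acts ts))"

lemma ctr_step_Carry:
  assumes "\<And>l. l < n \<Longrightarrow> f (i + l) = 1"
  shows "(ctr_step x ^^ n) ((q, Carry), [(i, f), t]) =
    ((q, Carry), [(i + n, \<lambda>j. if i \<le> j \<and> j < i + n then 2 else f j), t])"
  using assms
proof (induction n)
  case (Suc n)
  then have "f (i + n) = 1" by simp
  then show ?case
    using Suc by (auto simp: ctr_step_def read_tape_def act_tape_def[of "(2, MoveR)"] fun_eq_iff)
qed auto

text \<open>These \<open>i\<close> steps read the cells \<open>i, ..., 1\<close>, none of which
  holds the marker 3; cell 0 is reached but not yet read.\<close>

lemma ctr_step_Return:
  assumes "\<And>j. \<lbrakk>0 < j; j \<le> i\<rbrakk> \<Longrightarrow> f j \<noteq> 3"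
  shows "(ctr_step x ^^ i) ((q, Return), [(i, f), t]) = ((q, Return), [(0, f), t])"
  using assms
proof (induction i)
  case (Suc i)
  then have "f (Suc i) \<noteq> 3" by simp
  then show ?case
    using Suc
    by (simp add: ctr_step_def read_tape_def act_tape_def[of "(_, MoveL)"] funpow_Suc_right del: funpow.simps)
qed auto

text \<open>Configurations are compared between increments only. The symbol 3 is excluded beyond
  cell 0 so that \<open>Return\<close> cannot stop too early; \<open>s\<close> records the
  potential.\<close>

definition simulates :: "'q seq_config \<Rightarrow> ('q \<times> mode) \<times> tape list \<Rightarrow> nat \<Rightarrow> bool" where
  "simulates c C s \<longleftrightarrow> (case c of (q, t, n) \<Rightarrow> \<exists>f. C = ((q, Main), [(0, f), t]) \<and>
     finite (ones f) \<and> card (ones f) = s \<and> address (0, f) = n \<and> (\<forall>j>0. f j \<noteq> 3))"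

text \<open>The number of ones in the counter is the potential in the amortised analysis.\<close>

lemma simulates_step:
  assumes "simulates c C s"
  shows "\<exists>k s'. simulates (seq_step x c) ((ctr_step x ^^ k) C) s' \<and> k + 2 * s' \<le> 2 * s + 3"
proof -
  obtain q t n f where c: "c = (q, t, n)" and C: "C = ((q, Main), [(0, f), t])"
    and f: "finite (ones f)" "card (ones f) = s" "address (0, f) = n" "\<forall>j>0. f j \<noteq> 3"
    using assms by (cases c) (auto simp: simulates_def)
  show ?thesis
  proof (cases "q = qa \<or> q = qr")
    case True
    then have "seq_step x c = c" by (simp add: c seq_step_def)
    then show ?thesis using assms by (intro exI[of _ "0::nat"] exI[of _ s]) simp
  next
    case False
    obtain q' w m adv where d: "\<delta> q (query_input x n) (read_tape t) = (q', w, m, adv)"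
      by (metis prod_cases4)
    have step: "seq_step x c = (q', act_tape (w, m) t, n + of_bool adv)"
      using False d by (simp add: c seq_step_def)
    let ?t = "act_tape (w, m) t"
    show ?thesis
    proof (cases adv)
      case adv: False
      have "ctr_step x C = ((q', Main), [(0, f), ?t])"
        using False d adv f(3) by (simp add: C ctr_step_def read_tape_def act_tape_def[of "(_, Stay)"])
      then have "simulates (seq_step x c) ((ctr_step x ^^ 1) C) s"
        using f adv by (simp add: step simulates_def)
      moreover have "1 + 2 * s \<le> 2 * s + 3" by simp
        ultimately show ?thesis by blast
    next
      case adv: True
      have ex: "\<exists>j. f j \<noteq> 1"
      proof (rule ccontr)
        assume "\<nexists>j. f j \<noteq> 1"
        then have "ones f = UNIV" by (auto simp: ones_def)
        then show False using f(1) by simp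
      qed
      \<comment> \<open>The carry stops at the first cell that is not 1; such a cell exists because
        the counter has finitely many ones.\<close>
      define l where "l = (LEAST j. f j \<noteq> 1)"
      have l: "f l \<noteq> 1" "\<And>j. j < l \<Longrightarrow> f j = 1"
        using LeastI_ex[OF ex] not_less_Least unfolding l_def by blast+
      show ?thesis
      proof (cases l)
        case 0
        then have f0: "f 0 \<noteq> 1" using l by simp
        let ?f = "f(0 := 1)"
        have "ctr_step x C = ((q', Main), [(0, ?f), ?t])"
          using False d adv f(3) f0 by (simp add: C ctr_step_def read_tape_def act_tape_def[of "(_, Stay)"])
        moreover note address_increment[of f 0 ?f 0 0, OF f(1) f0]
        ultimately have "simulates (seq_step x c) ((ctr_step x ^^ 1) C) (s + 1)"
          using f adv by (simp add: step simulates_def)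
        moreover have "1 + 2 * (s + 1) \<le> 2 * s + 3" by simp
        ultimately show ?thesis by blast
      next
        case (Suc i)
        let ?g = "\<lambda>j. if j = 0 then 3 else if j < l then 2 else f j"
        let ?f = "?g(l := 1)"
        have f0: "f 0 = 1" using l Suc by simp
        have 1: "ctr_step x C = ((q', Carry), [(1, f(0 := 3)), ?t])"
          using False d adv f(3) f0 by (simp add: C ctr_step_def read_tape_def act_tape_def[of "(_, MoveR)"])
        have "(ctr_step x ^^ i) ((q', Carry), [(1, f(0 := 3)), ?t]) =
            ((q', Carry), [(1 + i, \<lambda>j. if 1 \<le> j \<and> j < 1 + i then 2 else (f(0 := 3)) j), ?t])"
          by (rule ctr_step_Carry) (use l Suc in simp)
        also have "(\<lambda>j. if 1 \<le> j \<and> j < 1 + i then 2 else (f(0 := 3)) j) = ?g"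
          using Suc by (auto simp: fun_eq_iff)
        finally have 2: "(ctr_step x ^^ i) ((q', Carry), [(1, f(0 := 3)), ?t]) =
            ((q', Carry), [(l, ?g), ?t])" by (simp only: Suc plus_1_eq_Suc)
        have 3: "ctr_step x ((q', Carry), [(l, ?g), ?t]) = ((q', Return), [(i, ?f), ?t])"
          using l Suc by (simp add: ctr_step_def read_tape_def act_tape_def[of "(_, MoveL)"])
        have 4: "(ctr_step x ^^ i) ((q', Return), [(i, ?f), ?t]) = ((q', Return), [(0, ?f), ?t])"
          by (rule ctr_step_Return) (use f(4) Suc in auto)
        have 5: "ctr_step x ((q', Return), [(0, ?f), ?t]) = ((q', Main), [(0, ?f), ?t])"
          using Suc by (auto simp: ctr_step_def read_tape_def act_tape_def[of "(_, Stay)"])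
        have run: "(ctr_step x ^^ (1 + (i + (1 + (i + 1))))) C = ((q', Main), [(0, ?f), ?t])"
          using funpow.simps(2)[of 0 "ctr_step x"]
          by (simp only: funpow_add o_apply One_nat_def[symmetric] funpow_0 funpow.simps(1) o_id 1 2 3 4 5)
        note inc = address_increment[of f l ?f 0 0, OF f(1) l]
        have inc: "finite (ones ?f)" "address (0, ?f) = n + 1" "card (ones ?f) + l = s + 1"
          using inc Suc f(2,3) by auto
        have "simulates (seq_step x c) ((ctr_step x ^^ (1 + (i + (1 + (i + 1))))) C) (card (ones ?f))"
          unfolding run step using f(4) adv inc Suc by (simp add: simulates_def)
        \<comment> \<open>With \<open>l = i + 1\<close> the increment takes \<open>2 * l + 1\<close>
          steps, while twice the number of ones drops by \<open>2 * l - 2\<close>; the amortised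
          cost is 3.\<close>
        moreover have "(1 + (i + (1 + (i + 1)))) + 2 * card (ones ?f) \<le> 2 * s + 3"
          using inc(3) Suc by simp
        ultimately show ?thesis by blast
      qed
    qed
  qed
qed

text \<open>The amortised costs telescope, since the blank counter has potential 0.\<close>

lemma simulates_steps:
  "\<exists>k s. simulates ((seq_step x ^^ n) seq_init)
     ((ctr_step x ^^ k) ((q0, Main), replicate 2 (0, \<lambda>_. 0))) s \<and> k + 2 * s \<le> 3 * n"
proof (induction n)
  case 0
  show ?case
    by (intro exI[of _ 0]) (simp add: simulates_def seq_init_def ones_def address_def numeral_2_eq_2)
next
  case (Suc n)
  then obtain k s where k: "k + 2 * s \<le> 3 * n"
    "simulates ((seq_step x ^^ n) seq_init)
       ((ctr_step x ^^ k) ((q0, Main), replicate 2 (0, \<lambda>_. 0))) s" by blast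
  from simulates_step[OF k(2), of x] obtain k' s' where
    "simulates (seq_step x ((seq_step x ^^ n) seq_init))
       ((ctr_step x ^^ k') ((ctr_step x ^^ k) ((q0, Main), replicate 2 (0, \<lambda>_. 0)))) s'"
    "k' + 2 * s' \<le> 2 * s + 3" by blast
  then show ?case using k(1)
    by (intro exI[of _ "k' + k"] exI[of _ s']) (simp add: funpow_add)
qed

text \<open>Numbering the finitely many states turns the counter machine into a random access
  machine. The simulation costs a factor 3, and since the halting states are absorbing, the run may
  be prolonged to exactly \<open>3 * c * (length x + 1)\<close> steps.\<close>

lemma DLINTIME_I:
  assumes "L \<subseteq> lists A"
    and halts: "\<And>x. x \<in> lists A \<Longrightarrow>
      \<exists>k\<le>c * (length x + 1). fst ((seq_step x ^^ k) seq_init) = (if x \<in> L then qa else qr)"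
  shows "L \<in> DLINTIME A"
proof -
  define P where "P = Q \<times> {Main, Carry, Return}"
  have "finite P" using finite_Q by (simp add: P_def)
  then obtain e where "bij_betw e P {0..<card P}"
    using ex_bij_betw_finite_nat by blast
  then have inj: "inj_on e P" and e: "\<And>p. p \<in> P \<Longrightarrow> e p < card P"
    and surj: "\<And>n. n < card P \<Longrightarrow> the_inv_into P e n \<in> P"
    by (auto simp: bij_betw_def intro!: the_inv_into_into[OF _ _ subset_refl])
  \<comment> \<open>The halting states have mode \<open>Main\<close>, so an increment begun on
    entering \<open>qa\<close> or \<open>qr\<close> is still completed.\<close>
  define M :: "'i ratm" where
    "M = \<lparr>num_states = card P, num_symbols = 4, num_tapes = 2, start_state = e (q0, Main),
      acc_state = e (qa, Main), rej_state = e (qr, Main),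
      trans = (\<lambda>n x rs. map_prod e id (ctr_trans (the_inv_into P e n) x rs))\<rparr>"
  have PQ: "(q, m) \<in> P \<longleftrightarrow> q \<in> Q" for q m
    by (cases m) (auto simp: P_def)
  have closed: "fst (ctr_trans p x rs) \<in> P \<and> length (snd (ctr_trans p x rs)) = 2 \<and>
      (length rs = 2 \<and> set rs \<subseteq> {..<4} \<longrightarrow> fst ` set (snd (ctr_trans p x rs)) \<subseteq> {..<4})"
    if "p \<in> P" "x \<in> {None} \<union> Some ` A" for p x rs
  proof -
    obtain q m where p: "p = (q, m)" by fastforce
    then have "q \<in> Q" using that PQ by simp
    obtain q' w m' adv where d: "\<delta> q x (rs ! 1) = (q', w, m', adv)" by (metis prod_cases4)
    note cl = \<delta>_closed[OF \<open>q \<in> Q\<close> that(2) d]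
    have "rs ! 0 < 4" "rs ! 1 < 4" if "length rs = 2" "set rs \<subseteq> {..<4}"
      using that nth_mem[of 0 rs] nth_mem[of 1 rs] by (auto simp: subset_iff)
    then show ?thesis
      using cl d \<open>q \<in> Q\<close> by (cases m) (auto simp: p PQ)
  qed
  have wf: "wf_ratm A M"
    unfolding wf_ratm_def
    using e special_states PQ inj closed surj
    by (auto simp: M_def inj_on_eq_iff split_beta)
  have step: "ratm_step M x (e p, ts) = map_prod e id (ctr_step x (p, ts))"
    if "p \<in> P" for x p ts
    using that special_states PQ inj
    by (auto simp: ratm_step_def ctr_step_def M_def inj_on_eq_iff the_inv_into_f_f split_beta)
  have run: "ratm_run M x k = map_prod e id ((ctr_step x ^^ k) ((q0, Main), replicate 2 (0, \<lambda>_. 0)))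
      \<and> fst ((ctr_step x ^^ k) ((q0, Main), replicate 2 (0, \<lambda>_. 0))) \<in> P"
    if x: "x \<in> lists A" for x k
  proof (induction k)
    case 0
    show ?case using special_states PQ by (simp add: ratm_run_def ratm_init_def M_def)
  next
    case (Suc k)
    define C where "C = (ctr_step x ^^ k) ((q0, Main), replicate 2 (0, \<lambda>_. 0))"
    have "ratm_run M x (Suc k) = map_prod e id (ctr_step x C)"
      using Suc step[of "fst C" x "snd C"] by (simp add: ratm_run_def C_def map_prod_def split_beta)
    moreover have "fst C \<in> P" using Suc by (simp add: C_def)
    then have "fst (ctr_step x C) \<in> P"
      using closed[OF _ query_input_in[OF x]] by (simp add: ctr_step_def split_beta)
    ultimately show ?case by (simp add: C_def id_def)
  qed
  have "fst (ratm_run M x (3 * c * (length x + 1))) =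
      (if x \<in> L then acc_state M else rej_state M)" if x: "x \<in> lists A" for x
  proof -
    obtain k where k: "k \<le> c * (length x + 1)"
      "fst ((seq_step x ^^ k) seq_init) = (if x \<in> L then qa else qr)"
      using halts[OF x] by blast
    let ?C = "\<lambda>l. (ctr_step x ^^ l) ((q0, Main), replicate 2 (0, \<lambda>_. 0))"
    obtain l s where l: "simulates ((seq_step x ^^ k) seq_init) (?C l) s" "l + 2 * s \<le> 3 * k"
      using simulates_steps by blast
    have fst: "fst (?C l) = (if x \<in> L then (qa, Main) else (qr, Main))"
      using l(1) k(2) by (auto simp: simulates_def split: prod.splits)
    then have "ctr_step x (?C l) = ?C l"
      by (auto simp: ctr_step_def split: prod.splits if_splits)
    then have stay: "(ctr_step x ^^ j) (?C l) = ?C l" for j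
      by (induction j) auto
    have "l \<le> 3 * c * (length x + 1)" using l(2) k(1) by (simp add: algebra_simps)
    then have "?C (3 * c * (length x + 1)) = ?C l"
      using stay[of "3 * c * (length x + 1) - l"] funpow_add[of "3 * c * (length x + 1) - l" l "ctr_step x"]
      by simp
    then show ?thesis
      using run[OF x, of "3 * c * (length x + 1)"] fst by (simp add: M_def)
  qed
  then show ?thesis
    unfolding DLINTIME_def using assms(1) finite_A wf by blast
qed

end


section \<open>Words generated by a substitution\<close>

lemma binary_value_simps [simp]:
  "binary_value [] = 0"
  "binary_value (bs @ [b]) = 2 * binary_value bs + of_bool b"
  by (simp_all add: binary_value_def)

lemma binary_value_append:
  "binary_value (bs @ cs) = 2 ^ length cs * binary_value bs + binary_value cs"
proof (induction cs rule: rev_induct)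
  case (snoc c cs)
  then show ?case by (simp add: algebra_simps flip: append_assoc)
qed simp

lemma binary_value_less: "binary_value bs < 2 ^ length bs"
proof (induction bs rule: rev_induct)
  case (snoc b bs)
  then show ?case by (cases b) auto
qed simp

lemma binary_value_eq_0_iff: "binary_value bs = 0 \<longleftrightarrow> True \<notin> set bs"
  by (induction bs rule: rev_induct) auto

lemma length_concat_const:
  "(\<And>x. x \<in> set xs \<Longrightarrow> length (f x) = k) \<Longrightarrow> length (concat (map f xs)) = k * length xs"
  by (induction xs) auto

lemma nth_concat_const:
  assumes "\<And>x. x \<in> set xs \<Longrightarrow> length (f x) = k" and "i < length xs" and "j < k"
  shows "concat (map f xs) ! (k * i + j) = f (xs ! i) ! j"
  using assms
proof (induction xs arbitrary: i)
  case (Cons x xs)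
  then show ?case by (cases i) (auto simp: nth_append)
qed simp

text \<open>\<open>Store\<close> copies \<open>v\<close> to the work tape and \<open>Rewind\<close>
  returns to its beginning. \<open>Scan a z bs\<close> holds the letter found so far, whether the
  position read so far is 0, and the bits of the unfinished block. \<open>Final a\<close> expects
  the letter \<open>a\<close>, and \<open>End\<close> the end of the input.\<close>

datatype 's ctrl = Init | Store | Rewind | Scan "'s letter" bool "bool list"
  | Final "'s letter" | End | Accept | Reject

text \<open>In the application \<open>sub a\<close> spells the image under \<open>\<sigma>\<close>
  of the letter \<open>a\<close>, \<open>tw\<close> spells \<open>t\<close>, and \<open>seed\<close>
  is a letter with non-trivial value.\<close>

locale subst_words =
  fixes S :: "'s set" and \<mu> :: nat and sub :: "'s letter \<Rightarrow> 's letter list"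
    and tw :: "'s letter list" and seed :: "'s letter"
  assumes finite_S: "finite S" and \<mu>_pos: "0 < \<mu>"
    and sub: "\<And>a. a \<in> std_alphabet S \<Longrightarrow> length (sub a) = 2 ^ \<mu> \<and> set (sub a) \<subseteq> std_alphabet S"
    and tw: "length tw = 2 ^ \<mu>" "set tw \<subseteq> std_alphabet S"
    and seed: "seed \<in> std_alphabet S"
begin

text \<open>The last bit of \<open>v\<close> decides the outermost operation, so the recursion runs
  over the reversed list. The word for \<open>t\<close> is padded to the length
  \<open>2 ^ \<mu>\<close> to the power of the depth.\<close>

fun leaf_rev :: "bool list \<Rightarrow> 's letter list" where
  "leaf_rev [] = [seed]"
| "leaf_rev (c # v) =
     (if c then concat (map sub (leaf_rev v))
      else tw @ replicate (2 ^ (\<mu> * Suc (length v)) - 2 ^ \<mu>) Unit)"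

definition leaf :: "bool list \<Rightarrow> 's letter list" where
  "leaf v = leaf_rev (rev v)"

lemma leaf_simps [simp]:
  "leaf [] = [seed]"
  "leaf (v @ [True]) = concat (map sub (leaf v))"
  "leaf (v @ [False]) = tw @ replicate (2 ^ (\<mu> * Suc (length v)) - 2 ^ \<mu>) Unit"
  by (simp_all add: leaf_def)

lemma Unit_in: "Unit \<in> std_alphabet S"
  by (simp add: std_alphabet_def)

lemma leaf_props: "set (leaf v) \<subseteq> std_alphabet S \<and> length (leaf v) = 2 ^ (\<mu> * length v)"
proof (induction v rule: rev_induct)
  case (snoc c v)
  have "(2::nat) ^ \<mu> \<le> 2 ^ (\<mu> * Suc (length v))"
    by (rule power_increasing) auto
  moreover have "set (concat (map sub (leaf v))) \<subseteq> std_alphabet S"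
    using snoc sub by fastforce
  moreover have "length (concat (map sub (leaf v))) = 2 ^ \<mu> * length (leaf v)"
    using snoc sub by (intro length_concat_const) blast
  ultimately show ?case
    using snoc tw Unit_in by (cases c) (auto simp: power_add)
qed (use seed in simp)

text \<open>Reading the position in blocks of \<open>\<mu>\<close> bits, most significant block first, in parallel to
  \<open>v\<close> determines the letter: with \<open>u\<close> the part of \<open>v\<close> read so far, one keeps track of the letter
  \<open>a\<close> of \<^term>\<open>leaf u\<close> at the position read so far, and of whether this position is 0.\<close>

definition next_letter :: "'s letter \<Rightarrow> bool \<Rightarrow> bool \<Rightarrow> bool list \<Rightarrow> 's letter" where
  "next_letter a z c bs =
     (if c then sub a ! binary_value bs else if z then tw ! binary_value bs else Unit)"

fun letter_at :: "'s letter \<Rightarrow> bool \<Rightarrow> bool list \<Rightarrow> bool list \<Rightarrow> 's letter" where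
  "letter_at a z [] bs = a"
| "letter_at a z (c # v) bs =
     letter_at (next_letter a z c (take \<mu> bs)) (z \<and> True \<notin> set (take \<mu> bs)) v (drop \<mu> bs)"

text \<open>\<open>letter_at\<close> consumes \<open>v\<close> from the front, whereas
  \<open>leaf\<close> recurses at its end; this reconciles the two.\<close>

lemma letter_at_snoc:
  assumes "length bs = \<mu> * length v" and "length cs = \<mu>"
  shows "letter_at a z (v @ [c]) (bs @ cs) =
    next_letter (letter_at a z v bs) (z \<and> True \<notin> set bs) c cs"
  using assms(1)
proof (induction v arbitrary: a z bs)
  case Nil
  then show ?case using assms(2) by simp
next
  case (Cons c' v)
  have "True \<notin> set bs \<longleftrightarrow> True \<notin> set (take \<mu> bs) \<and> True \<notin> set (drop \<mu> bs)"
    by (metis Un_iff append_take_drop_id set_append)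
  then show ?case
    using Cons.IH[of "drop \<mu> bs"] Cons.prems by simp
qed

text \<open>Write the position as \<open>2 ^ \<mu> * i + j\<close> with \<open>j\<close> the last
  block. After a final \<open>True\<close> it is place \<open>j\<close> in the image of the
  \<open>i\<close>-th letter of the shorter word; after a final \<open>False\<close> it lies in
  \<open>tw\<close> if \<open>i = 0\<close> and in the padding otherwise.\<close>

lemma letter_at_leaf:
  "length bs = \<mu> * length v \<Longrightarrow> letter_at seed True v bs = leaf v ! binary_value bs"
proof (induction v arbitrary: bs rule: rev_induct)
  case (snoc c v)
  define as where "as = take (\<mu> * length v) bs"
  define cs where "cs = drop (\<mu> * length v) bs"
  have bs: "bs = as @ cs" and len: "length as = \<mu> * length v" "length cs = \<mu>"
    using snoc.prems by (auto simp: as_def cs_def)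
  have cs_less: "binary_value cs < 2 ^ \<mu>" using binary_value_less[of cs] len by simp
  have as_less: "binary_value as < 2 ^ (\<mu> * length v)" using binary_value_less[of as] len by simp
  have at: "letter_at seed True v as = leaf v ! binary_value as" by (rule snoc.IH[OF len(1)])
  have val: "binary_value bs = 2 ^ \<mu> * binary_value as + binary_value cs"
    using len by (simp add: bs binary_value_append)
  have L: "letter_at seed True (v @ [c]) bs =
      next_letter (leaf v ! binary_value as) (True \<notin> set as) c cs"
    using letter_at_snoc[OF len, of seed True c] at by (simp add: bs)
  show ?case
  proof (cases c)
    case True
    have "concat (map sub (leaf v)) ! (2 ^ \<mu> * binary_value as + binary_value cs) =
        sub (leaf v ! binary_value as) ! binary_value cs"
      using leaf_props[of v] sub as_less cs_less by (intro nth_concat_const) auto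
    then show ?thesis using L by (simp add: val next_letter_def True)
  next
    case c: False
    show ?thesis
    proof (cases "True \<in> set as")
      case False
      then have "binary_value as = 0" by (simp add: binary_value_eq_0_iff)
      then show ?thesis using L False c cs_less tw by (simp add: val next_letter_def nth_append)
    next
      case True
      then have "1 \<le> binary_value as"
        using binary_value_eq_0_iff[of as] by simp
      then have "2 ^ \<mu> * 1 \<le> 2 ^ \<mu> * binary_value as" by (rule mult_le_mono2)
      then have "2 ^ \<mu> \<le> binary_value bs" using val by linarith
      moreover have "binary_value bs < 2 ^ (\<mu> * Suc (length v))"
        using binary_value_less[of bs] snoc.prems by simp
      ultimately show ?thesis using L True c tw by (simp add: next_letter_def nth_append)
    qed
  qed
qed simp

lemma next_letter_in:
  assumes "a \<in> std_alphabet S" "length bs = \<mu>"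
  shows "next_letter a z c bs \<in> std_alphabet S"
  using assms binary_value_less[of bs] sub[of a] tw Unit_in
  by (auto simp: next_letter_def intro: subsetD)

section \<open>The binary tree of nested commutators over the leaves\<close>

function tree_word :: "nat \<Rightarrow> bool list \<Rightarrow> 's letter list" where
  "tree_word d v = (if length v < d
     then word_comm (tree_word d (v @ [False])) (tree_word d (v @ [True])) else leaf v)"
  by pat_completeness auto
termination by (relation "measure (\<lambda>(d, v). d - length v)") auto

declare tree_word.simps [simp del]

lemma tree_word_leaf: "length v = d \<Longrightarrow> tree_word d v = leaf v"
  by (simp add: tree_word.simps)

lemma set_tree_word: "set (tree_word d v) \<subseteq> std_alphabet S"
proof (induction d v rule: tree_word.induct)
  case (1 d v)
  show ?case
  proof (cases "length v < d")
    case True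
    then show ?thesis
      using 1 by (subst tree_word.simps) (simp add: word_comm_def set_word_inv)
  qed (use leaf_props in \<open>simp add: tree_word.simps\<close>)
qed


section \<open>The letters of the words are decidable in linear time\<close>

text \<open>A description on lists of what the automaton accepts, separating the identification of
  the language from the handling of tapes. Here \<open>v\<close> is the part of the stored word not
  yet consumed.\<close>

fun scan_accepts :: "'s letter \<Rightarrow> bool \<Rightarrow> bool list \<Rightarrow> bool list \<Rightarrow> 's insym list \<Rightarrow> bool" where
  "scan_accepts a z bs v (Bit b # s) =
     (if Suc (length bs) < \<mu> then scan_accepts a z (bs @ [b]) v s
      else case v of [] \<Rightarrow> False | c # v' \<Rightarrow>
        scan_accepts (next_letter a z c (bs @ [b])) (z \<and> True \<notin> set (bs @ [b])) [] v' s)"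
| "scan_accepts a z bs v (Sep # s) = (bs = [] \<and> v = [] \<and> s = [Letter a])"
| "scan_accepts a z bs v _ = False"

fun store_accepts :: "bool list \<Rightarrow> 's insym list \<Rightarrow> bool" where
  "store_accepts v (Bit b # s) = store_accepts (v @ [b]) s"
| "store_accepts v (Sep # s) = scan_accepts seed True [] v s"
| "store_accepts v _ = False"

lemma scan_accepts_iff:
  "length bs < \<mu> \<Longrightarrow> scan_accepts a z bs v s \<longleftrightarrow>
    (\<exists>cs. s = map Bit cs @ [Sep, Letter (letter_at a z v (bs @ cs))] \<and>
       length (bs @ cs) = \<mu> * length v)"
proof (induction a z bs v s rule: scan_accepts.induct)
  case (1 a z bs v b s)
  have cs: "(\<exists>cs. Bit b # s = map Bit cs @ [Sep, Letter (F cs)] \<and> P cs) \<longleftrightarrow>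
      (\<exists>cs. s = map Bit cs @ [Sep, Letter (F (b # cs))] \<and> P (b # cs))" for F P
  proof
    assume "\<exists>cs. Bit b # s = map Bit cs @ [Sep, Letter (F cs)] \<and> P cs"
    then obtain cs where "Bit b # s = map Bit cs @ [Sep, Letter (F cs)]" "P cs" by blast
    then show "\<exists>cs. s = map Bit cs @ [Sep, Letter (F (b # cs))] \<and> P (b # cs)"
      by (cases cs) auto
  next
    assume "\<exists>cs. s = map Bit cs @ [Sep, Letter (F (b # cs))] \<and> P (b # cs)"
    then obtain cs where "s = map Bit cs @ [Sep, Letter (F (b # cs))] \<and> P (b # cs)" by blast
    then show "\<exists>cs. Bit b # s = map Bit cs @ [Sep, Letter (F cs)] \<and> P cs"
      by (intro exI[of _ "b # cs"]) simp
  qed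
  show ?case
  proof (cases "Suc (length bs) < \<mu>")
    case True
    then show ?thesis using 1 unfolding cs by simp
  next
    case False
    then have len: "Suc (length bs) = \<mu>" using 1 by simp
    show ?thesis
    proof (cases v)
      case Nil
      then show ?thesis unfolding cs using False by simp
    next
      case (Cons c v')
      have "take \<mu> (bs @ b # cs) = bs @ [b]" "drop \<mu> (bs @ b # cs) = cs" for cs
        by (simp_all flip: len)
      moreover have "length (bs @ b # cs) = \<mu> * length (c # v') \<longleftrightarrow> length cs = \<mu> * length v'" for cs
        using len by auto
      ultimately show ?thesis
        unfolding cs using 1(2)[OF False Cons] \<mu>_pos False by (simp add: Cons)
    qed
  qed
next
  case (2 a z bs v s)
  \<comment> \<open>A multiple of \<open>\<mu>\<close> below \<open>\<mu>\<close> is 0, and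
    \<open>\<mu>\<close> is positive: the separator must come at a block boundary with
    \<open>v\<close> used up.\<close>
  have "length bs = \<mu> * length v \<longleftrightarrow> bs = [] \<and> v = []"
    using 2 \<mu>_pos by (cases v) auto
  moreover have "(Sep # s = map Bit cs @ [Sep, Letter l]) \<longleftrightarrow> cs = [] \<and> s = [Letter l]" for cs l
    by (cases cs) auto
  ultimately show ?case by auto
next
  case ("3_2" a z bs v l s)
  have "(Letter l # s = map Bit cs @ [Sep, Letter l']) \<longleftrightarrow> False" for cs l'
    by (cases cs) auto
  then show ?case by simp
qed simp

lemma store_accepts_iff:
  "store_accepts u x \<longleftrightarrow> (\<exists>v s. x = map Bit v @ Sep # s \<and> scan_accepts seed True [] (u @ v) s)"
proof (induction u x rule: store_accepts.induct)
  case (1 u b s)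
  have "(Bit b # s = map Bit v @ Sep # s') \<longleftrightarrow> (\<exists>v'. v = b # v' \<and> s = map Bit v' @ Sep # s')" for v s'
    by (cases v) auto
  then show ?case using 1 by auto
next
  case (2 u s)
  have "(Sep # s = map Bit v @ Sep # s') \<longleftrightarrow> v = [] \<and> s = s'" for v and s' :: "'s insym list"
    by (cases v) auto
  then show ?case by auto
next
  case ("3_2" u l s)
  have "Letter l # s \<noteq> map Bit v @ Sep # s'" for v s'
    by (cases v) auto
  then show ?case by simp
qed simp

lemma letter_language_iff: "x \<in> letter_language S \<mu> tree_word \<longleftrightarrow> store_accepts [] x"
proof -
  have in_alph: "leaf v ! binary_value bs \<in> std_alphabet S" if "length bs = \<mu> * length v" for v bs
    using leaf_props[of v] binary_value_less[of bs] that by (auto intro: subsetD)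
  let ?P = "\<lambda>v bs. x = map Bit v @ Sep # map Bit bs @ [Sep, Letter (leaf v ! binary_value bs)] \<and>
    length bs = \<mu> * length v"
  have "store_accepts [] x \<longleftrightarrow> (\<exists>v bs. ?P v bs)"
    unfolding store_accepts_iff using \<mu>_pos
    by (simp add: scan_accepts_iff) (metis letter_at_leaf)
  moreover have "x \<in> letter_language S \<mu> tree_word \<longleftrightarrow> (\<exists>v bs. ?P v bs)"
    unfolding letter_language_def encode_query_def
    by (simp add: tree_word_leaf) (metis in_alph)
  ultimately show ?thesis by simp
qed

text \<open>The bits of \<open>v\<close> are stored as 1 and 2, so that the blank marks both ends:
  \<open>Init\<close> leaves cell 0 blank for \<open>Rewind\<close> to stop at, and in
  \<open>Scan\<close> a blank means that \<open>v\<close> is used up.\<close>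

fun \<delta> :: "'s ctrl \<Rightarrow> 's insym option \<Rightarrow> nat \<Rightarrow> 's ctrl \<times> nat \<times> move \<times> bool" where
  "\<delta> Init _ r = (Store, 0, MoveR, False)"
| "\<delta> Store (Some (Bit b)) r = (Store, if b then 1 else 2, MoveR, True)"
| "\<delta> Store (Some Sep) r = (Rewind, 0, MoveL, True)"
| "\<delta> Rewind _ r = (if r = 0 then (Scan seed True [], 0, MoveR, False) else (Rewind, r, MoveL, False))"
| "\<delta> (Scan a z bs) (Some (Bit b)) r =
     (if Suc (length bs) < \<mu> then (Scan a z (bs @ [b]), r, Stay, True)
      else if r = 0 then (Reject, 0, Stay, False)
      else (Scan (next_letter a z (r = 1) (bs @ [b])) (z \<and> True \<notin> set (bs @ [b])) [], r, MoveR, True))"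
| "\<delta> (Scan a z bs) (Some Sep) r = (if bs = [] \<and> r = 0 then Final a else Reject, r, Stay, True)"
| "\<delta> (Final a) (Some (Letter b)) r = (if a = b then End else Reject, r, Stay, True)"
| "\<delta> End None r = (Accept, r, Stay, False)"
| "\<delta> _ _ r = (Reject, r, Stay, False)"

text \<open>A full block is consumed at once, so only blocks shorter than \<open>\<mu>\<close> are
  remembered; this keeps the set finite.\<close>

definition states :: "'s ctrl set" where
  "states = {Init, Store, Rewind, End, Accept, Reject} \<union> Final ` std_alphabet S \<union>
     (\<lambda>(a, z, bs). Scan a z bs) ` (std_alphabet S \<times> UNIV \<times> {bs. length bs < \<mu>})"

lemma finite_std_alphabet: "finite (std_alphabet S)"
  using finite_S by (simp add: std_alphabet_def)

lemma \<delta>_states: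
  assumes "q \<in> states" "\<delta> q x r = (q', w, m, adv)"
  shows "q' \<in> states \<and> (r < 4 \<longrightarrow> w < 4)"
  using assms
  by (cases "(q, x, r)" rule: \<delta>.cases)
    (auto simp: states_def seed \<mu>_pos image_iff intro!: next_letter_in split: if_splits)

sublocale seq_machine "query_alphabet S" states \<delta> Init Accept Reject
proof
  show "finite (query_alphabet S)"
    using finite_std_alphabet by (simp add: query_alphabet_def)
  have "{bs :: bool list. length bs < \<mu>} \<subseteq> {bs. set bs \<subseteq> UNIV \<and> length bs \<le> \<mu>}" by auto
  then have "finite {bs :: bool list. length bs < \<mu>}"
    using finite_lists_length_le[OF finite_UNIV] finite_subset by blast
  then show "finite states"
    using finite_std_alphabet by (simp add: states_def)
qed (use \<delta>_states in \<open>auto simp: states_def\<close>)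

section \<open>Correctness and running time of the automaton\<close>

definition stored :: "bool list \<Rightarrow> nat \<Rightarrow> nat" where
  "stored v j =
     (case j of 0 \<Rightarrow> 0 | Suc i \<Rightarrow> if i < length v then if v ! i then 1 else 2 else 0)"

definition halts_within :: "'s insym list \<Rightarrow> 's ctrl seq_config \<Rightarrow> nat \<Rightarrow> bool \<Rightarrow> bool" where
  "halts_within x c n b \<longleftrightarrow> (\<exists>k\<le>n. fst ((seq_step x ^^ k) c) = (if b then Accept else Reject))"

lemma halts_within_now: "fst c = (if b then Accept else Reject) \<Longrightarrow> halts_within x c n b"
  by (auto simp: halts_within_def intro: exI[of _ 0])

lemma halts_within_step:
  assumes "seq_step x c = c'" and "halts_within x c' m b" and "m < n"
  shows "halts_within x c n b"
proof -
  obtain k where "k \<le> m" "fst ((seq_step x ^^ k) (seq_step x c)) = (if b then Accept else Reject)"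
    using assms by (auto simp: halts_within_def)
  then show ?thesis
    unfolding halts_within_def using assms(3)
    by (intro exI[of _ "Suc k"]) (simp add: funpow_Suc_right del: funpow.simps)
qed

lemma query_input_append:
  "query_input (p @ s) (length p) = (case s of [] \<Rightarrow> None | a # _ \<Rightarrow> Some a)"
  by (cases s) (auto simp: query_input_def)

lemma read_stored:
  "read_tape (Suc i, stored v) = (case drop i v of [] \<Rightarrow> 0 | c # _ \<Rightarrow> if c then 1 else 2)"
  by (cases "i < length v") (auto simp: read_tape_def stored_def Cons_nth_drop_Suc[symmetric])

lemma stored_upd: "(stored v)(Suc (length v) := if b then 1 else 2) = stored (v @ [b])"
  by (auto simp: stored_def fun_eq_iff nth_append split: nat.splits)

lemma act_tape_stored_Stay [simp]:
  "act_tape (read_tape t, m) t = (move_head m (fst t), snd t)"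
  by (simp add: act_tape_def read_tape_def)

lemma halts_within_next:
  assumes "fst (seq_step x c) = (if b then Accept else Reject)" and "0 < n"
  shows "halts_within x c n b"
  using halts_within_step[OF refl halts_within_now] assms by blast

text \<open>Each input symbol costs one step, and the constant leaves room for noticing the end of
  the input. The prefix \<open>p\<close> has been read and \<open>i\<close> bits of \<open>v\<close>
  have been consumed.\<close>

lemma scan_halts:
  assumes "length bs < \<mu>" and "x = p @ s"
  shows "halts_within x (Scan a z bs, (Suc i, stored v), length p) (length s + 3)
    (scan_accepts a z bs (drop i v) s)"
  using assms
proof (induction s arbitrary: p a z bs i)
  case Nil
  have "query_input x (length p) = None"
    using Nil by (simp add: query_input_def)
  then show ?case
    by (auto simp: seq_step_def intro!: halts_within_next)
next
  case (Cons y s)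
  have query: "query_input x (length p) = Some y"
    using Cons.prems by (simp add: query_input_append)
  have x: "x = (p @ [y]) @ s" using Cons.prems by simp
  show ?case
  proof (cases y)
    case (Bit b)
    show ?thesis
    proof (cases "Suc (length bs) < \<mu>")
      case True
      then have "seq_step x (Scan a z bs, (Suc i, stored v), length p) =
          (Scan a z (bs @ [b]), (Suc i, stored v), length (p @ [y]))"
        by (simp add: seq_step_def query Bit)
      then show ?thesis
        using True Bit halts_within_step[OF _ Cons.IH[OF _ x, of "bs @ [b]"]] by simp
    next
      case False
      then have len: "Suc (length bs) = \<mu>" using Cons.prems by simp
      show ?thesis
      proof (cases "drop i v")
        case Nil
        then show ?thesis
          using False by (auto simp: seq_step_def query Bit read_stored intro!: halts_within_next)
      next
        case (Cons c v')
        then have v': "drop (Suc i) v = v'" by (metis drop_Suc list.sel(3) tl_drop)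
        have r: "read_tape (Suc i, stored v) \<noteq> 0" "read_tape (Suc i, stored v) = 1 \<longleftrightarrow> c"
          using Cons by (auto simp: read_stored)
        have "seq_step x (Scan a z bs, (Suc i, stored v), length p) =
            (Scan (next_letter a z c (bs @ [b])) (z \<and> True \<notin> set (bs @ [b])) [],
             (Suc (Suc i), stored v), length (p @ [y]))"
          using False r by (simp add: seq_step_def query Bit)
        then show ?thesis
          using False Bit Cons v' \<mu>_pos halts_within_step[OF _ Cons.IH[OF _ x, of "[]" _ _ "Suc i"]]
          by simp
      qed
    qed
  next
    case Sep
    show ?thesis
    proof (cases "bs = [] \<and> drop i v = []")
      case False
      then have "fst (seq_step x (Scan a z bs, (Suc i, stored v), length p)) = Reject"
        by (auto simp: seq_step_def query Sep read_stored split: list.splits)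
      then show ?thesis using False Sep by (auto intro!: halts_within_next)
    next
      case True
      then have r: "read_tape (Suc i, stored v) = 0" by (simp add: read_stored)
      then have 1: "seq_step x (Scan a z bs, (Suc i, stored v), length p) =
          (Final a, (Suc i, stored v), Suc (length p))"
        using True act_tape_stored_Stay[of "(Suc i, stored v)" Stay]
        by (simp add: seq_step_def query Sep)
      show ?thesis
      proof (cases "s = [] \<or> hd s \<noteq> Letter a")
        case bad: True
        then have "fst (seq_step x (Final a, (Suc i, stored v), Suc (length p))) = Reject"
          using query_input_append[of "p @ [y]" s] x
          by (cases s; cases "hd s") (auto simp: seq_step_def)
        then have "halts_within x (Final a, (Suc i, stored v), Suc (length p)) 1 False"
          by (intro halts_within_next) simp_all
        with 1 have "halts_within x (Scan a z bs, (Suc i, stored v), length p) (length (y # s) + 3) False"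
          by (rule halts_within_step) simp
        moreover have "\<not> scan_accepts a z bs (drop i v) (y # s)"
          using bad Sep by auto
        ultimately show ?thesis by simp
      next
        case good: False
        then obtain s' where s: "s = Letter a # s'" by (cases s) auto
        have 2: "seq_step x (Final a, (Suc i, stored v), Suc (length p)) =
            (End, (Suc i, stored v), Suc (Suc (length p)))"
          using query_input_append[of "p @ [y]" s] x s by (simp add: seq_step_def)
        have 3: "fst (seq_step x (End, (Suc i, stored v), Suc (Suc (length p)))) =
            (if s' = [] then Accept else Reject)"
          using query_input_append[of "p @ [y, Letter a]" s'] x s
          by (cases s') (auto simp: seq_step_def)
        from 3 have "halts_within x (End, (Suc i, stored v), Suc (Suc (length p))) 1 (s' = [])"
          by (rule halts_within_next) simp
        with 2 have "halts_within x (Final a, (Suc i, stored v), Suc (length p)) 2 (s' = [])"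
          by (rule halts_within_step) simp
        with 1 have "halts_within x (Scan a z bs, (Suc i, stored v), length p) (length (y # s) + 3) (s' = [])"
          by (rule halts_within_step) simp
        moreover have "scan_accepts a z bs (drop i v) (y # s) \<longleftrightarrow> s' = []"
          using True Sep s by simp
        ultimately show ?thesis by simp
      qed
    qed
  next
    case (Letter l)
    then show ?thesis
      by (auto simp: seq_step_def query intro!: halts_within_next)
  qed
qed

text \<open>There are \<open>i\<close> moves to the left and one move from the blank cell 0 into
  cell 1.\<close>

lemma rewind_halts:
  assumes "halts_within x (Scan seed True [], (1, stored v), n) m b"
    and "i \<le> length v"
  shows "halts_within x (Rewind, (i, stored v), n) (m + Suc i) b"
  using assms(2)
proof (induction i)
  case 0
  have "seq_step x (Rewind, (0, stored v), n) = (Scan seed True [], (1, stored v), n)"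
    by (simp add: seq_step_def read_tape_def act_tape_def stored_def fun_eq_iff)
  then show ?case by (rule halts_within_step[OF _ assms(1)]) simp
next
  case (Suc i)
  then have "seq_step x (Rewind, (Suc i, stored v), n) = (Rewind, (i, stored v), n)"
    by (auto simp: seq_step_def read_tape_def act_tape_def stored_def fun_eq_iff split: nat.splits)
  then show ?case by (rule halts_within_step[OF _ Suc.IH]) (use Suc.prems in simp_all)
qed

text \<open>Symbols still to be read count twice, because a bit that is stored now is passed again
  when rewinding; the bits already stored count once.\<close>

lemma store_halts:
  assumes "x = p @ s"
  shows "halts_within x (Store, (Suc (length v), stored v), length p)
    (2 * length s + length v + 5) (store_accepts v s)"
  using assms
proof (induction s arbitrary: p v)
  case Nil
  have "query_input x (length p) = None"
    using Nil by (simp add: query_input_def)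
  then show ?case
    by (auto simp: seq_step_def intro!: halts_within_next)
next
  case (Cons y s)
  have query: "query_input x (length p) = Some y"
    using Cons.prems by (simp add: query_input_append)
  have x: "x = (p @ [y]) @ s" using Cons.prems by simp
  show ?case
  proof (cases y)
    case (Bit b)
    have "seq_step x (Store, (Suc (length v), stored v), length p) =
        (Store, (Suc (length (v @ [b])), stored (v @ [b])), length (p @ [y]))"
      using stored_upd[of v b] by (simp add: seq_step_def query Bit act_tape_def)
    then have "halts_within x (Store, (Suc (length v), stored v), length p)
        (2 * length (y # s) + length v + 5) (store_accepts (v @ [b]) s)"
      by (rule halts_within_step[OF _ Cons.IH[OF x]]) simp
    then show ?thesis using Bit by simp
  next
    case Sep
    have "stored v (Suc (length v)) = 0" by (simp add: stored_def)
    then have 1: "seq_step x (Store, (Suc (length v), stored v), length p) =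
        (Rewind, (length v, stored v), length (p @ [y]))"
      by (simp add: seq_step_def query Sep act_tape_def fun_upd_idem)
    have "halts_within x (Scan seed True [], (Suc 0, stored v), length (p @ [y])) (length s + 3)
        (scan_accepts seed True [] (drop 0 v) s)"
      by (rule scan_halts) (use \<mu>_pos x in auto)
    then have "halts_within x (Rewind, (length v, stored v), length (p @ [y]))
        (length s + 3 + Suc (length v)) (store_accepts v (y # s))"
      using Sep by (intro rewind_halts) auto
    with 1 show ?thesis by (rule halts_within_step) simp
  next
    case (Letter l)
    then show ?thesis
      by (auto simp: seq_step_def query intro!: halts_within_next)
  qed
qed

lemma letter_language_DLINTIME:
  "letter_language S \<mu> tree_word \<in> DLINTIME (query_alphabet S)"
proof (rule DLINTIME_I)
  show "letter_language S \<mu> tree_word \<subseteq> lists (query_alphabet S)"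
    by (auto simp: letter_language_def encode_query_def query_alphabet_def)
  fix x :: "'s insym list"
  have empty: "stored [] = (\<lambda>_. 0)" by (simp add: stored_def fun_eq_iff split: nat.splits)
  have "seq_step x seq_init = (Store, (Suc (length []), stored []), length [])"
    by (simp add: seq_step_def seq_init_def act_tape_def empty fun_eq_iff)
  then have "halts_within x seq_init (6 * (length x + 1)) (store_accepts [] x)"
    by (rule halts_within_step[OF _ store_halts]) simp_all
  then show "\<exists>k\<le>6 * (length x + 1). fst ((seq_step x ^^ k) seq_init) =
      (if x \<in> letter_language S \<mu> tree_word then Accept else Reject)"
    by (simp add: halts_within_def letter_language_iff)
qed

end


section \<open>Nested commutators in groups containing their own wreath products\<close>

theorem theorem29:
  fixes G :: "('a, 'm) monoid_scheme" and H :: "('h, 'n) monoid_scheme"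
  assumes "group G" and "finitely_generated G"
    and "group H" and "carrier H \<noteq> {\<one>\<^bsub>H\<^esub>}"
    and "\<exists>K. subgroup K G \<and> wreath_product G H \<cong> G\<lparr>carrier := K\<rparr>"
  shows "uniformly_SENS G"
proof -
  interpret group G by fact
  interpret H: group H by fact
  obtain h where h: "h \<in> carrier H" "h \<noteq> \<one>\<^bsub>H\<^esub>"
    using assms(4) H.one_closed by blast
  obtain K \<phi> where K: "subgroup K G" and iso: "\<phi> \<in> iso (wreath_product G H) (G\<lparr>carrier := K\<rparr>)"
    using assms(5) by (auto simp: is_iso_def)
  have hom: "\<phi> \<in> hom (wreath_product G H) G"
    using iso subgroup.mem_carrier[OF K] by (auto simp: iso_def hom_def)
  have inj: "inj_on \<phi> (carrier (wreath_product G H))"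
    using iso by (auto simp: iso_def bij_betw_def)
  obtain \<sigma> t P where \<sigma>: "\<sigma> \<in> hom G G" and t: "t \<in> carrier G" and t_one: "t \<noteq> \<one>\<^bsub>G\<^esub>"
    and P_one: "\<And>g. P \<one>\<^bsub>G\<^esub> g \<Longrightarrow> g = \<one>\<^bsub>G\<^esub>"
    and P_mult: "\<And>x y g k. \<lbrakk>P x g; P y k\<rbrakk> \<Longrightarrow> P (x \<otimes>\<^bsub>G\<^esub> y) (g \<otimes>\<^bsub>G\<^esub> k)"
    and P_inv: "\<And>x g. P x g \<Longrightarrow> P (inv\<^bsub>G\<^esub> x) (inv\<^bsub>G\<^esub> g)"
    and P_comm: "\<And>g. g \<in> carrier G \<Longrightarrow> P (inv\<^bsub>G\<^esub> t \<otimes>\<^bsub>G\<^esub> (inv\<^bsub>G\<^esub> (\<sigma> g) \<otimes>\<^bsub>G\<^esub> (t \<otimes>\<^bsub>G\<^esub> \<sigma> g))) g"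
    apply (rule wreath_embedding[OF assms(1,3) h hom inj])
    subgoal premises prems by (rule prems(1)[OF prems(2-)])
    done
  have "uniformly_SENS_wrt G S \<iota>" if std: "std_generators G S \<iota>" for S :: "nat set" and \<iota>
  proof -
    have \<iota>: "\<iota> ` S \<subseteq> carrier G" and S: "finite S"
      using std by (auto simp: std_generators_def)
    let ?ev = "word_eval G \<iota>" and ?\<Sigma> = "std_alphabet S"
    have "carrier G \<noteq> {\<one>\<^bsub>G\<^esub>}" using t t_one by blast
    then obtain seed where seed: "seed \<in> ?\<Sigma>" "letter_eval G \<iota> seed \<noteq> \<one>\<^bsub>G\<^esub>"
      using ex_nontrivial_letter[OF std] by blast
    have letter: "letter_eval G \<iota> a \<in> carrier G" if "a \<in> ?\<Sigma>" for a
      using letter_eval_closed[OF \<iota> that] .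
    \<comment> \<open>Only \<open>t\<close> and the images of the letters have to be spelled, so one
      \<open>\<mu>\<close> serves all of them.\<close>
    have "finite (insert t ((\<lambda>a. \<sigma> (letter_eval G \<iota> a)) ` ?\<Sigma>))"
      using S by (simp add: std_alphabet_def)
    moreover have "insert t ((\<lambda>a. \<sigma> (letter_eval G \<iota> a)) ` ?\<Sigma>) \<subseteq> carrier G"
      using t letter hom_in_carrier[OF \<sigma>] by auto
    ultimately obtain \<mu> where "\<mu> > 0" and words:
      "\<forall>x\<in>insert t ((\<lambda>a. \<sigma> (letter_eval G \<iota> a)) ` ?\<Sigma>).
         \<exists>w. set w \<subseteq> ?\<Sigma> \<and> length w = 2 ^ \<mu> \<and> ?ev w = x"
      using ex_words_of_equal_length[OF std] by blast
    obtain tw where tw: "set tw \<subseteq> ?\<Sigma>" "length tw = 2 ^ \<mu>" "?ev tw = t"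
      using words by blast
    have "\<forall>a\<in>?\<Sigma>. \<exists>w. set w \<subseteq> ?\<Sigma> \<and> length w = 2 ^ \<mu> \<and> ?ev w = \<sigma> (letter_eval G \<iota> a)"
      using words by simp
    then obtain sub where sub: "\<And>a. a \<in> ?\<Sigma> \<Longrightarrow> set (sub a) \<subseteq> ?\<Sigma> \<and> length (sub a) = 2 ^ \<mu> \<and>
        ?ev (sub a) = \<sigma> (letter_eval G \<iota> a)"
      unfolding bchoice_iff by blast
    interpret W: subst_words S \<mu> sub tw seed
      by unfold_locales (use S \<open>\<mu> > 0\<close> sub tw seed in auto)
    have closed: "?ev w \<in> carrier G" if "set w \<subseteq> ?\<Sigma>" for w
      using word_eval_closed[OF \<iota> that] .
    have \<sigma>_one: "\<sigma> \<one>\<^bsub>G\<^esub> = \<one>\<^bsub>G\<^esub>"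
      using hom_one[OF \<sigma>] is_group by blast
    have ev_sub: "?ev (concat (map sub w)) = \<sigma> (?ev w)" if "set w \<subseteq> ?\<Sigma>" for w
      using that
    proof (induction w)
      case (Cons a w)
      then have "set (sub a) \<subseteq> ?\<Sigma>" "set (concat (map sub w)) \<subseteq> ?\<Sigma>"
        using sub by auto
      then show ?case
        using Cons sub letter closed hom_mult[OF \<sigma>] word_eval_append[OF \<iota>] by simp
    qed (simp add: \<sigma>_one)
    have leaf_False: "?ev (W.leaf (v @ [False])) = t" for v
      using tw word_eval_append[OF \<iota> tw(1), of "replicate n Unit" for n] W.Unit_in t
      by (auto simp: set_replicate_conv_if)
    have leaf_True: "?ev (W.leaf (v @ [True])) = \<sigma> (?ev (W.leaf v))" for v
      using ev_sub W.leaf_props by simp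
    have comm: "?ev (W.tree_word d v) = inv\<^bsub>G\<^esub> (?ev (W.tree_word d (v @ [False]))) \<otimes>\<^bsub>G\<^esub>
        (inv\<^bsub>G\<^esub> (?ev (W.tree_word d (v @ [True]))) \<otimes>\<^bsub>G\<^esub>
         (?ev (W.tree_word d (v @ [False])) \<otimes>\<^bsub>G\<^esub> ?ev (W.tree_word d (v @ [True]))))"
      if "length v < d" for d v
      using that word_eval_word_comm[OF \<iota> W.set_tree_word W.set_tree_word]
      by (subst W.tree_word.simps) simp
    \<comment> \<open>Induction on the distance from depth \<open>d\<close>. At distance 0 the two
      leaves below \<open>v\<close> evaluate to \<open>t\<close> and to the image under
      \<open>\<sigma>\<close> of the leaf at \<open>v\<close>, so \<open>P_comm\<close> applies;
      above, \<open>P\<close> respects products and inverses and hence commutators.\<close>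
    have P_words: "P (?ev (W.tree_word (Suc d) v)) (?ev (W.tree_word d v))" if "length v \<le> d" for d v
      using that
    proof (induction "d - length v" arbitrary: v)
      case 0
      then have "length v = d" by simp
      then show ?case
        using comm[of v "Suc d"] P_comm[OF closed] W.leaf_props[of v]
        by (simp add: W.tree_word_leaf leaf_False leaf_True del: W.leaf_simps)
    next
      case (Suc n)
      then have "P (?ev (W.tree_word (Suc d) (v @ [b]))) (?ev (W.tree_word d (v @ [b])))" for b
        by simp
      then show ?case
        using Suc comm[of v "Suc d"] comm[of v d] by (simp add: P_mult P_inv)
    qed
    \<comment> \<open>If the root word for \<open>Suc d\<close> were trivial, then so would be its
      value at position \<open>\<one>\<close>, which is the value of the root word for
      \<open>d\<close>.\<close>
    have nontrivial: "?ev (W.tree_word d []) \<noteq> \<one>\<^bsub>G\<^esub>" for d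
    proof (induction d)
      case 0
      then show ?case using seed letter by (simp add: W.tree_word_leaf)
    next
      case (Suc d)
      then show ?case using P_words[of "[]" d] P_one by force
    qed
    have "sens_words G S \<iota> \<mu> W.tree_word"
      unfolding sens_words_def
      using W.set_tree_word W.leaf_props nontrivial
      by (auto simp: W.tree_word_leaf W.tree_word.simps[of _ v for v] simp del: W.leaf_simps)
    then show ?thesis
      unfolding uniformly_SENS_wrt_def using W.letter_language_DLINTIME by blast
  qed
  then show ?thesis
    using assms(2) by (simp add: uniformly_SENS_def)
qed

end
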